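(* Let $\mathbb{H}$ be a field with $\mathbb{Q}\subset\mathbb{H}\subset\mathbb{C}$, let $A\in\mathbb{H}^{n\times n}$ and let $$p_A(\lambda)=g_1(\lambda)^{d_1}\cdot g_2(\lambda)^{d_2}\cdots g_r(\lambda)^{d_r}$$ be the factorization of its characteristic polynomial into elementary factors (the elementary divisors $g_j(\lambda)^{d_j}$ of $A$ over $\mathbb{H}$, listed with repetition), with each $g_j(\lambda)\in\mathbb{H}[\lambda]$ an irreducible monic polynomial of degree $k_j$ (the $g_j$ need not be distinct), so $\sum_{j=1}^r k_jd_j=n$. Then there is an invertible matrix $T\in\mathbb{H}^{n\times n}$ such that $$A=T^{-1}(C_1\oplus C_2\oplus\cdots\oplus C_r)T,$$ where each $C_j$ is the $d_jk_j\times d_jk_j$ block upper triangular matrix $$C_j=\begin{bmatrix} C_{g_j}&I_{k_j}&0&\cdots&0\\0&C_{g_j}&I_{k_j}&\ddots&\vdots\\ \vdots&\ddots&\ddots&\ddots&0\\ \vdots&&\ddots&C_{g_j}&I_{k_j}\\0&\cdots&\cdots&0&C_{g_j}\end{bmatrix}$$ with $d_j$ diagonal blocks. This form is unique up to permutation of the blocks $C_1,\dots,C_r$ in the direct sum.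
   Context: The companion matrix of a monic polynomial $g(\lambda)=\lambda^k+a_{k-1}\lambda^{k-1}+\cdots+a_0$ is the $k\times k$ matrix $C_g$ with ones on the first superdiagonal, last row $(-a_0,-a_1,\dots,-a_{k-1})$, and zeros elsewhere (so $C_g=[-a_0]$ if $k=1$). $\oplus$ denotes block diagonal direct sum. *)

theory Defs
  imports Complex_Main "HOL-Library.Multiset" "Jordan_Normal_Form.Char_Poly"
begin

(* The diagonal f_1 | f_2 | ... | f_n of the Smith normal form of lambda*I - A over H[lambda];
   invertible_mat at the polynomial type means invertible over H[lambda], i.e. unimodular. *)
definition invariant_factors :: "'a::field mat \<Rightarrow> 'a poly list \<Rightarrow> bool" where
  "invariant_factors A fs \<longleftrightarrow>
     length fs = dim_row A \<and>
     (\<forall>f \<in> set fs. monic f) \<and>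
     (\<forall>i. Suc i < length fs \<longrightarrow> fs ! i dvd fs ! Suc i) \<and>
     (\<exists>P Q. P \<in> carrier_mat (dim_row A) (dim_row A) \<and>
            Q \<in> carrier_mat (dim_row A) (dim_row A) \<and>
            invertible_mat P \<and> invertible_mat Q \<and>
            P * char_poly_matrix A * Q = mat_diag (dim_row A) (\<lambda>i. fs ! i))"

(* The prime powers g^d occurring in the factorization of f, encoded as pairs (g, d).
   The index set of mset_set is finite whenever f is nonzero. *)
definition primary_factors :: "'a::field poly \<Rightarrow> ('a poly \<times> nat) multiset" where
  "primary_factors f =
     mset_set {(g, d). monic g \<and> irreducible g \<and> d \<ge> 1 \<and> g ^ d dvd f \<and> \<not> g ^ Suc d dvd f}"

(* A prime power occurring in several invariant factors is listed once for each of them. *)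
definition elementary_divisors :: "'a::field mat \<Rightarrow> ('a poly \<times> nat) multiset \<Rightarrow> bool" where
  "elementary_divisors A E \<longleftrightarrow>
     (\<exists>fs. invariant_factors A fs \<and> E = (\<Sum>f\<in>#mset fs. primary_factors f))"

definition companion_matrix :: "'a::field poly \<Rightarrow> 'a mat" where
  "companion_matrix g =
     mat (degree g) (degree g)
       (\<lambda>(i, j). if Suc i = degree g then - coeff g j
                 else if j = Suc i then 1 else 0)"

(* Entry (i, j) lies in the block with block indices (i div k, j div k), at position
   (i mod k, j mod k) inside that block. *)
definition gen_jordan_block :: "'a::field poly \<Rightarrow> nat \<Rightarrow> 'a mat" where
  "gen_jordan_block g d = (let k = degree g in
     mat (d * k) (d * k)
       (\<lambda>(i, j). if j div k = i div k then companion_matrix g $$ (i mod k, j mod k)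
                 else if j div k = Suc (i div k) then 1\<^sub>m k $$ (i mod k, j mod k)
                 else 0))"

end

theory Submission
  imports Defs "Jordan_Normal_Form.Jordan_Normal_Form_Uniqueness"
begin

text \<open>
Let \<open>K\<close> be the field, \<open>x I - A = P\<^sup>-\<^sup>1 F Q\<^sup>-\<^sup>1\<close> with \<open>P\<close>, \<open>Q\<close>
unimodular and \<open>F\<close> the diagonal matrix of the invariant factors \<open>f\<close>.

\<^emph>\<open>Existence.\<close> Let \<open>K[x]\<close> act on rows over \<open>K\<close>, with \<open>x\<close> acting as \<open>A\<close> on the right. The map
\<open>v \<mapsto> v Q\<close> sends multiples of \<open>x I - A\<close> to multiples of \<open>F\<close>, so it identifies this module with
the direct sum of the \<open>K[x]/(f)\<close>, hence with the direct sum of the \<open>K[x]/(g ^ d)\<close> over all elementary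
divisors. On one summand take as coordinates of \<open>q\<close> the remainders modulo \<open>g\<close> of the Taylor
coefficients \<open>q\<^sup>(\<^sup>b\<^sup>)/b!\<close> for \<open>b < d\<close>. This is the substitution \<open>x = y + t\<close> into
\<open>K[y, t]/(g(y), t ^ d)\<close>, read in the basis of the monomials \<open>t ^ b y ^ r\<close>; multiplication by \<open>x\<close>
becomes multiplication by \<open>y\<close>, which is the companion matrix on each diagonal block, plus
multiplication by \<open>t\<close>, which is the identity on each superdiagonal block
(\<open>taylor_coord_X_mult\<close>). In characteristic 0 an irreducible \<open>g\<close> does not divide its derivative,
and this makes the vanishing of all coordinates equivalent to divisibility by \<open>g ^ d\<close>
(\<open>taylor_coord_eq_0_iff\<close>).

So the matrix \<open>S\<close> whose rows are the coordinates of the rows of \<open>Q\<close> satisfies \<open>A S = S B\<close>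
for the block diagonal matrix \<open>B\<close>. If \<open>v S = 0\<close>, then \<open>v Q = w F\<close> for some \<open>w\<close>, so the constant
row \<open>v\<close> equals \<open>w P (x I - A)\<close>, which for degree reasons forces \<open>v = 0\<close>
(\<open>constant_row_multiple_eq_0\<close>). The degrees of the elementary divisors add up to the size of \<open>A\<close>,
because the characteristic polynomial is the product of the invariant factors; hence \<open>S\<close> is square
and therefore invertible.

\<^emph>\<open>Uniqueness.\<close> Over the complex numbers an irreducible \<open>g\<close> is a product of distinct linear
factors, and the block of \<open>g ^ d\<close> is similar to the direct sum of the ordinary Jordan blocks of
size \<open>d\<close> at the roots of \<open>g\<close> (\<open>jordan_nf_gen_jordan_block\<close>). A complex number is a root of at
most one monic irreducible polynomial over \<open>K\<close>. So the multiplicity of \<open>(g, d)\<close> is the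
number of Jordan blocks of size \<open>d\<close> at any root of \<open>g\<close>, which depends only on \<open>A\<close>.
\<close>

section \<open>Divisibility by a prime power and higher derivatives\<close>

lemma degree_irreducible_pos:
  fixes g :: "'a::field poly"
  assumes "irreducible g"
  shows "degree g > 0"
  using assms by (auto simp: irreducible_def is_unit_iff_degree)

lemma irreducible_not_dvd_pderiv:
  fixes g :: "'a::field poly"
  assumes char: "CHAR('a) = 0" and g: "irreducible g"
  shows "\<not> g dvd pderiv g"
proof
  assume dvd: "g dvd pderiv g"
  obtain k where k: "degree g = Suc k"
    using degree_irreducible_pos[OF g] gr0_implies_Suc by blast
  have "coeff (pderiv g) k = of_nat (Suc k) * lead_coeff g"
    by (simp add: coeff_pderiv k)
  moreover have "lead_coeff g \<noteq> 0" using degree_irreducible_pos[OF g] by (metis degree_0 leading_coeff_0_iff less_irrefl)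
  moreover have "(of_nat (Suc k) :: 'a) \<noteq> 0"
    unfolding of_nat_eq_0_iff_char_dvd char by simp
  ultimately have "coeff (pderiv g) k \<noteq> 0" by simp
  hence "pderiv g \<noteq> 0" by (metis coeff_0)
  hence "degree g \<le> degree (pderiv g)" by (rule dvd_imp_degree_le[OF dvd])
  thus False using k degree_pderiv_le[of g] by linarith
qed

lemma power_dvd_pderiv:
  fixes g q :: "'a::field poly"
  assumes "g ^ Suc d dvd q"
  shows "g ^ d dvd pderiv q"
proof -
  obtain h where q: "q = g ^ Suc d * h" using assms unfolding dvd_def by blast
  have "pderiv q = g ^ d * (Polynomial.smult (of_nat (Suc d)) (pderiv g) * h + g * pderiv h)"
    unfolding q pderiv_mult pderiv_power_Suc by (simp add: algebra_simps)
  thus ?thesis by simp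
qed

lemma power_dvd_imp_dvd_higher_pderiv:
  fixes g q :: "'a::field poly"
  assumes "g ^ d dvd q" and "b < d"
  shows "g dvd (pderiv ^^ b) q"
  using assms
proof (induction b arbitrary: d q)
  case 0
  hence "g dvd g ^ d" by (intro dvd_power) simp
  also have "g ^ d dvd q" by (rule 0)
  finally show ?case by simp
next
  case (Suc b)
  then obtain e where e: "d = Suc e" by (cases d) auto
  have "g ^ e dvd pderiv q" using Suc.prems(1) power_dvd_pderiv unfolding e by blast
  from Suc.IH[OF this] Suc.prems(2) show ?case by (simp add: e funpow_swap1)
qed

text \<open>
In the step from \<open>d\<close> to \<open>d + 1\<close> the induction hypothesis applies to \<open>q\<close> and to its derivative.
If \<open>q = g ^ d * h\<close> and \<open>g ^ d\<close> divides \<open>pderiv q\<close>, then the product rule leaves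
\<open>g dvd d * pderiv g * h\<close>. In characteristic 0 the prime \<open>g\<close> divides neither \<open>d\<close> nor \<open>pderiv g\<close>,
so it divides \<open>h\<close>.
\<close>
lemma dvd_higher_pderivs_imp_power_dvd:
  fixes g q :: "'a::field poly"
  assumes char: "CHAR('a) = 0" and g: "irreducible g"
    and "\<And>b. b < d \<Longrightarrow> g dvd (pderiv ^^ b) q"
  shows "g ^ d dvd q"
  using assms(3)
proof (induction d arbitrary: q)
  case 0
  show ?case by simp
next
  case (Suc d)
  have prime: "prime_elem g" using g by (rule field_poly_irreducible_imp_prime)
  have gq: "g dvd q" using Suc.prems[of 0] by simp
  show ?case
  proof (cases d)
    case 0
    with gq show ?thesis by simp
  next
    case e: (Suc e)
    have "g ^ d dvd q" by (rule Suc.IH) (rule Suc.prems, simp)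
    then obtain h where q: "q = g ^ d * h" unfolding dvd_def by blast
    have "g ^ d dvd pderiv q"
    proof (rule Suc.IH)
      fix b assume "b < d"
      thus "g dvd (pderiv ^^ b) (pderiv q)" using Suc.prems[of "Suc b"] by (simp add: funpow_swap1)
    qed
    moreover have "pderiv q = g ^ d * pderiv h + g ^ e * Polynomial.smult (of_nat d) (pderiv g * h)"
      unfolding q pderiv_mult e pderiv_power_Suc by (simp add: algebra_simps)
    ultimately have "g ^ e * g dvd g ^ e * Polynomial.smult (of_nat d) (pderiv g * h)"
      using dvd_add_right_iff[of "g ^ d" "g ^ d * pderiv h"] e by (simp add: mult.commute)
    hence "g dvd Polynomial.smult (of_nat d) (pderiv g * h)"
      using g by (subst (asm) dvd_mult_cancel_left) auto
    moreover have "(of_nat d :: 'a) \<noteq> 0"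
      unfolding of_nat_eq_0_iff_char_dvd char e by simp
    ultimately have "g dvd pderiv g * h" by (simp add: dvd_smult_iff)
    hence "g dvd h"
      using prime irreducible_not_dvd_pderiv[OF char g] prime_elem_dvd_mult_iff by blast
    thus ?thesis unfolding q by (simp add: mult.commute mult_dvd_mono)
  qed
qed

section \<open>Taylor coordinates modulo an irreducible polynomial\<close>

text \<open>
The coefficient of \<open>t ^ b\<close> in \<open>q(y + t)\<close>, reduced modulo \<open>g(y)\<close>. The factorial is
written as an image of a natural number because the field is not assumed to be of class
\<open>field_char_0\<close>.
\<close>
definition taylor_residue :: "'a::field poly \<Rightarrow> 'a poly \<Rightarrow> nat \<Rightarrow> 'a poly" where
  "taylor_residue g q b = Polynomial.smult (inverse (of_nat (fact b))) ((pderiv ^^ b) q) mod g"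

text \<open>
The position \<open>s = b * degree g + r\<close> stands for the basis element \<open>t ^ b y ^ r\<close> of
\<open>K[y, t]/(g(y), t ^ d)\<close>, in the order used by \<open>gen_jordan_block\<close>.
\<close>
definition taylor_coord :: "'a::field poly \<Rightarrow> 'a poly \<Rightarrow> nat \<Rightarrow> 'a" where
  "taylor_coord g q s = coeff (taylor_residue g q (s div degree g)) (s mod degree g)"

lemma pderiv_funpow_add: "(pderiv ^^ b) (p + q) = (pderiv ^^ b) p + (pderiv ^^ b) q"
  for p q :: "'a::field poly"
  by (induction b arbitrary: p q) (simp_all add: pderiv_add)

lemma pderiv_funpow_smult: "(pderiv ^^ b) (Polynomial.smult c p) = Polynomial.smult c ((pderiv ^^ b) p)"
  for p :: "'a::field poly"
  by (induction b arbitrary: p) (simp_all add: pderiv_smult)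

lemma pderiv_funpow_X_mult:
  fixes q :: "'a::field poly"
  shows "(pderiv ^^ b) ([:0, 1:] * q) =
    [:0, 1:] * (pderiv ^^ b) q + Polynomial.smult (of_nat b) ((pderiv ^^ (b - 1)) q)"
proof (induction b)
  case 0
  show ?case by simp
next
  case (Suc b)
  have "(pderiv ^^ Suc b) ([:0, 1:] * q) = pderiv ((pderiv ^^ b) ([:0, 1:] * q))" by simp
  also have "\<dots> = pderiv ([:0, 1:] * (pderiv ^^ b) q + Polynomial.smult (of_nat b) ((pderiv ^^ (b - 1)) q))"
    by (simp only: Suc)
  also have "\<dots> = [:0, 1:] * (pderiv ^^ Suc b) q + (pderiv ^^ b) q
      + Polynomial.smult (of_nat b) (pderiv ((pderiv ^^ (b - 1)) q))"
    by (simp add: pderiv_add pderiv_smult pderiv_mult pderiv_pCons)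
  also have "Polynomial.smult (of_nat b) (pderiv ((pderiv ^^ (b - 1)) q)) = Polynomial.smult (of_nat b) ((pderiv ^^ b) q)"
    by (cases b) simp_all
  finally show ?case by (simp add: smult_add_left algebra_simps)
qed

lemma taylor_coord_add: "taylor_coord g (p + q) s = taylor_coord g p s + taylor_coord g q s"
  by (simp add: taylor_coord_def taylor_residue_def pderiv_funpow_add smult_add_right poly_mod_add_left)

lemma taylor_coord_smult: "taylor_coord g (Polynomial.smult c p) s = c * taylor_coord g p s"
proof -
  have "Polynomial.smult (inverse (of_nat (fact b))) (Polynomial.smult c r) = Polynomial.smult c (Polynomial.smult (inverse (of_nat (fact b))) r)"
    for b and r :: "'a poly" by (simp add: mult.commute)
  thus ?thesis unfolding taylor_coord_def taylor_residue_def pderiv_funpow_smult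
    by (simp only: mod_smult_left coeff_smult)
qed

lemma taylor_coord_0 [simp]: "taylor_coord g 0 s = 0"
  using taylor_coord_smult[of g 0 0 s] by simp

lemma taylor_coord_sum: "taylor_coord g (\<Sum>i\<in>I. f i) s = (\<Sum>i\<in>I. taylor_coord g (f i) s)"
  by (induction I rule: infinite_finite_induct) (simp_all add: taylor_coord_add)

lemma taylor_coord_eq_0_iff:
  fixes g q :: "'a::field poly"
  assumes char: "CHAR('a) = 0" and g: "irreducible g"
  shows "(\<forall>s < d * degree g. taylor_coord g q s = 0) \<longleftrightarrow> g ^ d dvd q"
proof -
  let ?k = "degree g"
  have k: "?k > 0" by (rule degree_irreducible_pos[OF g])
  have res: "taylor_residue g q b = 0 \<longleftrightarrow> g dvd (pderiv ^^ b) q" for b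
  proof -
    have "inverse (of_nat (fact b) :: 'a) \<noteq> 0"
      unfolding inverse_nonzero_iff_nonzero of_nat_eq_0_iff_char_dvd char by simp
    thus ?thesis unfolding taylor_residue_def mod_eq_0_iff_dvd by (rule dvd_smult_iff)
  qed
  have deg: "taylor_residue g q b = 0 \<or> degree (taylor_residue g q b) < ?k" for b
    unfolding taylor_residue_def using k by (intro degree_mod_less) auto
  have "(\<forall>s < d * ?k. taylor_coord g q s = 0) \<longleftrightarrow> (\<forall>b < d. taylor_residue g q b = 0)"
  proof (intro iffI allI impI)
    fix b assume *: "\<forall>s < d * ?k. taylor_coord g q s = 0" and b: "b < d"
    have "coeff (taylor_residue g q b) r = 0" for r
    proof (cases "r < ?k")
      case True
      have "Suc b * ?k \<le> d * ?k" using b by (intro mult_le_mono1) auto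
      hence "b * ?k + r < d * ?k" using True by simp
      with * have "taylor_coord g q (b * ?k + r) = 0" by blast
      thus ?thesis using True by (simp add: taylor_coord_def)
    next
      case False
      thus ?thesis using deg[of b] by (auto intro: coeff_eq_0)
    qed
    thus "taylor_residue g q b = 0" by (simp add: poly_eq_iff)
  next
    fix s assume "\<forall>b < d. taylor_residue g q b = 0" and "s < d * ?k"
    thus "taylor_coord g q s = 0" by (simp add: taylor_coord_def less_mult_imp_div_less)
  qed
  also have "\<dots> \<longleftrightarrow> g ^ d dvd q"
    unfolding res using dvd_higher_pderivs_imp_power_dvd[OF char g] power_dvd_imp_dvd_higher_pderiv
    by blast
  finally show ?thesis .
qed

text \<open>
This is the identity \<open>x q(x) = (y + t) q(y + t)\<close> compared at \<open>t ^ b\<close>.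
\<close>
lemma taylor_residue_X_mult:
  fixes g q :: "'a::field poly"
  assumes char: "CHAR('a) = 0" 
  shows "taylor_residue g ([:0, 1:] * q) b =
    ([:0, 1:] * taylor_residue g q b) mod g + (if b = 0 then 0 else taylor_residue g q (b - 1))"
proof -
  let ?c = "\<lambda>b. inverse (of_nat (fact b)) :: 'a"
  have "Polynomial.smult (?c b) ((pderiv ^^ b) ([:0, 1:] * q)) =
     [:0, 1:] * Polynomial.smult (?c b) ((pderiv ^^ b) q) + Polynomial.smult (?c b * of_nat b) ((pderiv ^^ (b - 1)) q)"
    unfolding pderiv_funpow_X_mult by (simp add: smult_add_right)
  also have "Polynomial.smult (?c b * of_nat b) ((pderiv ^^ (b - 1)) q) =
     (if b = 0 then 0 else Polynomial.smult (?c (b - 1)) ((pderiv ^^ (b - 1)) q))"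
  proof (cases b)
    case (Suc m)
    have "(of_nat (Suc m) :: 'a) \<noteq> 0" unfolding of_nat_eq_0_iff_char_dvd char by simp
    hence "?c (Suc m) * of_nat (Suc m) = ?c m"
      unfolding fact_Suc of_nat_id of_nat_mult nonzero_inverse_mult_distrib
      by (simp add: inverse_mult_distrib mult.commute mult.left_commute del: of_nat_Suc)
    thus ?thesis unfolding Suc by simp
  qed simp
  finally show ?thesis unfolding taylor_residue_def
    by (simp add: poly_mod_add_left mod_mult_right_eq del: mult_pCons_left)
qed

section \<open>Products with a generalised Jordan block\<close>

lemma companion_matrix_dim [simp]:
  "dim_row (companion_matrix g) = degree g" "dim_col (companion_matrix g) = degree g"
  by (simp_all add: companion_matrix_def)

lemma gen_jordan_block_dim [simp]:
  "dim_row (gen_jordan_block g d) = d * degree g" "dim_col (gen_jordan_block g d) = d * degree g"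
  by (simp_all add: gen_jordan_block_def Let_def)

lemma gen_jordan_block_carrier [simp]:
  "gen_jordan_block g d \<in> carrier_mat (d * degree g) (d * degree g)"
  by (rule carrier_matI) simp_all

lemma block_index_less:
  fixes b d r k :: nat
  assumes "b < d" "r < k"
  shows "b * k + r < d * k"
proof -
  have "Suc b * k \<le> d * k" using assms(1) by (intro mult_le_mono1) auto
  thus ?thesis using assms(2) by simp
qed

lemma gen_jordan_block_index:
  assumes "b < d" "r < degree g" "b' < d" "r' < degree g"
  shows "gen_jordan_block g d $$ (b * degree g + r, b' * degree g + r') =
    (if b' = b then companion_matrix g $$ (r, r') else if b' = Suc b \<and> r = r' then 1 else 0)"
proof -
  let ?k = "degree g"
  have "(b * ?k + r) div ?k = b" "(b * ?k + r) mod ?k = r"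
    "(b' * ?k + r') div ?k = b'" "(b' * ?k + r') mod ?k = r'"
    using assms by simp_all
  moreover have "b * ?k + r < d * ?k" "b' * ?k + r' < d * ?k"
    using assms block_index_less by blast+
  ultimately show ?thesis using assms by (simp add: gen_jordan_block_def Let_def del: mult_Suc)
qed

lemma sum_block_index:
  fixes f :: "nat \<Rightarrow> 'a::comm_monoid_add"
  shows "(\<Sum>t < d * k. f t) = (\<Sum>b < d. \<Sum>r < k. f (b * k + r))"
proof -
  have "(\<Sum>t < d * k. f t) = (\<Sum>b < d. sum f {b * k..<b * k + k})"
    by (rule sum.nat_group[symmetric])
  also have "\<dots> = (\<Sum>b < d. \<Sum>r < k. f (b * k + r))"
  proof (rule sum.cong[OF refl])
    fix b
    show "sum f {b * k..<b * k + k} = (\<Sum>r < k. f (b * k + r))"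
      using sum.shift_bounds_nat_ivl[of f 0 "b * k" k] by (simp add: atLeast0LessThan add.commute)
  qed
  finally show ?thesis .
qed

text \<open>
Column \<open>b * k + r\<close> of the block matrix meets only the diagonal block \<open>b\<close> and the identity block
above it, so two terms survive.
\<close>
lemma row_times_gen_jordan_block:
  fixes x :: "nat \<Rightarrow> 'a::field"
  assumes "b < d" "r < degree g"
  shows "(\<Sum>t < d * degree g. x t * gen_jordan_block g d $$ (t, b * degree g + r)) =
    (\<Sum>r' < degree g. x (b * degree g + r') * companion_matrix g $$ (r', r)) +
    (if b = 0 then 0 else x ((b - 1) * degree g + r))"
proof -
  let ?k = "degree g"
  have "(\<Sum>t < d * ?k. x t * gen_jordan_block g d $$ (t, b * ?k + r)) =
    (\<Sum>c < d. \<Sum>r' < ?k. x (c * ?k + r') *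
       (if b = c then companion_matrix g $$ (r', r) else if b = Suc c \<and> r' = r then 1 else 0))"
    unfolding sum_block_index using assms by (intro sum.cong) (simp_all add: gen_jordan_block_index)
  also have "\<dots> = (\<Sum>c < d. (if c = b then \<Sum>r' < ?k. x (b * ?k + r') * companion_matrix g $$ (r', r) else 0)
      + (if b = Suc c then x (c * ?k + r) else 0))"
  proof (rule sum.cong[OF refl])
    fix c assume "c \<in> {..<d}"
    consider "c = b" | "b = Suc c" | "c \<noteq> b" "b \<noteq> Suc c" by auto
    thus "(\<Sum>r' < ?k. x (c * ?k + r') *
       (if b = c then companion_matrix g $$ (r', r) else if b = Suc c \<and> r' = r then 1 else 0)) =
       (if c = b then \<Sum>r' < ?k. x (b * ?k + r') * companion_matrix g $$ (r', r) else 0)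
      + (if b = Suc c then x (c * ?k + r) else 0)"
      using assms(2) by cases (simp_all add: if_distrib[of "times _"] sum.delta cong: if_cong)
  qed
  also have "\<dots> = (\<Sum>r' < ?k. x (b * ?k + r') * companion_matrix g $$ (r', r)) +
    (if b = 0 then 0 else x ((b - 1) * ?k + r))"
    using assms(1) by (cases b) (simp_all add: sum.distrib sum.delta)
  finally show ?thesis .
qed

lemma gen_jordan_block_times_column:
  fixes y :: "nat \<Rightarrow> 'a::field"
  assumes "b < d" "r < degree g"
  shows "(\<Sum>t < d * degree g. gen_jordan_block g d $$ (b * degree g + r, t) * y t) =
    (\<Sum>r' < degree g. companion_matrix g $$ (r, r') * y (b * degree g + r')) +
    (if Suc b < d then y (Suc b * degree g + r) else 0)"
proof -
  let ?k = "degree g"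
  have "(\<Sum>t < d * ?k. gen_jordan_block g d $$ (b * ?k + r, t) * y t) =
    (\<Sum>c < d. \<Sum>r' < ?k.
       (if c = b then companion_matrix g $$ (r, r') else if c = Suc b \<and> r = r' then 1 else 0)
        * y (c * ?k + r'))"
    unfolding sum_block_index using assms by (intro sum.cong) (simp_all add: gen_jordan_block_index)
  also have "\<dots> = (\<Sum>c < d. (if c = b then \<Sum>r' < ?k. companion_matrix g $$ (r, r') * y (b * ?k + r') else 0)
      + (if c = Suc b then y (Suc b * ?k + r) else 0))"
  proof (rule sum.cong[OF refl])
    fix c assume "c \<in> {..<d}"
    consider "c = b" | "c = Suc b" | "c \<noteq> b" "c \<noteq> Suc b" by auto
    thus "(\<Sum>r' < ?k.
       (if c = b then companion_matrix g $$ (r, r') else if c = Suc b \<and> r = r' then 1 else 0)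
        * y (c * ?k + r')) =
       (if c = b then \<Sum>r' < ?k. companion_matrix g $$ (r, r') * y (b * ?k + r') else 0)
      + (if c = Suc b then y (Suc b * ?k + r) else 0)"
      using assms(2) by cases (simp_all add: if_distrib[of "\<lambda>z. z * y _"] sum.delta cong: if_cong)
  qed
  also have "\<dots> = (\<Sum>r' < ?k. companion_matrix g $$ (r, r') * y (b * ?k + r')) +
    (if Suc b < d then y (Suc b * ?k + r) else 0)"
    using assms(1) by (simp add: sum.distrib sum.delta)
  finally show ?thesis .
qed

text \<open>
Multiplication by \<open>x\<close> on \<open>K[x]/(g)\<close> in the basis of monomials, acting on coefficient rows.
\<close>
lemma companion_row_times:
  fixes p g :: "'a::field poly"
  assumes g: "monic g" and p: "p = 0 \<or> degree p < degree g" and r: "r < degree g"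
  shows "(\<Sum>r' < degree g. coeff p r' * companion_matrix g $$ (r', r)) =
    coeff (([:0, 1:] * p) mod g) r"
proof -
  obtain m where m: "degree g = Suc m" using r by (cases "degree g") auto
  define c where "c = coeff p m"
  let ?h = "[:0, 1:] * p - Polynomial.smult c g"
  have "coeff ?h i = 0" if "i \<ge> degree g" for i
  proof (cases "i = Suc m")
    case True
    thus ?thesis using g m by (simp add: c_def)
  next
    case False
    with that m have i: "i > Suc m" by simp
    then obtain j where j: "i = Suc j" "j > m" by (cases i) auto
    hence "coeff p j = 0" using p m by (auto intro: coeff_eq_0)
    moreover have "coeff g i = 0" using i m by (simp add: coeff_eq_0)
    ultimately show ?thesis using j by simp
  qed
  hence "?h = 0 \<or> degree ?h < degree g"
    by (metis leading_coeff_0_iff not_le)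
  hence "?h mod g = ?h" by (auto simp: mod_poly_less)
  moreover have "?h mod g = ([:0, 1:] * p) mod g"
    by (simp add: poly_mod_diff_left mod_smult_left del: mult_pCons_left)
  ultimately have "coeff (([:0, 1:] * p) mod g) r = coeff ?h r" by simp
  also have "\<dots> = (if r = 0 then 0 else coeff p (r - 1)) - c * coeff g r"
    by (cases r) simp_all
  also have "\<dots> = (\<Sum>r' < Suc m. coeff p r' * companion_matrix g $$ (r', r))"
  proof -
    have "(\<Sum>r' < m. coeff p r' * companion_matrix g $$ (r', r)) =
       (\<Sum>r' < m. if Suc r' = r then coeff p r' else 0)"
      using r m by (intro sum.cong) (auto simp: companion_matrix_def)
    also have "\<dots> = (if r = 0 then 0 else coeff p (r - 1))"
      using r m by (cases r) (auto simp: sum.delta)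
    finally show ?thesis using r m by (simp add: companion_matrix_def c_def)
  qed
  finally show ?thesis using m by simp
qed

text \<open>
The Taylor coordinates turn multiplication by \<open>x\<close> into the generalised Jordan block: the companion
part comes from \<open>y\<close>, the superdiagonal identity blocks from \<open>t\<close>.
\<close>
lemma taylor_coord_X_mult:
  fixes g q :: "'a::field poly"
  assumes char: "CHAR('a) = 0" and g: "monic g" and s: "s < d * degree g"
  shows "taylor_coord g ([:0, 1:] * q) s =
    (\<Sum>t < d * degree g. taylor_coord g q t * gen_jordan_block g d $$ (t, s))"
proof -
  let ?k = "degree g"
  define b r where "b = s div ?k" and "r = s mod ?k"
  have k: "?k > 0" using s by (cases "?k") auto
  have br: "b < d" "r < ?k" "s = b * ?k + r"
    using s k by (simp_all add: b_def r_def less_mult_imp_div_less)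
  have coord: "taylor_coord g f (c * ?k + r') = coeff (taylor_residue g f c) r'"
    if "r' < ?k" for f c r'
    using that by (simp add: taylor_coord_def)
  have deg: "taylor_residue g q b = 0 \<or> degree (taylor_residue g q b) < ?k"
    unfolding taylor_residue_def using k by (intro degree_mod_less) auto
  have "(\<Sum>t < d * ?k. taylor_coord g q t * gen_jordan_block g d $$ (t, s)) =
    coeff (([:0, 1:] * taylor_residue g q b) mod g) r +
     (if b = 0 then 0 else coeff (taylor_residue g q (b - 1)) r)"
    unfolding br(3) row_times_gen_jordan_block[OF br(1,2)] companion_row_times[OF g deg br(2), symmetric]
    using br(2) by (simp add: coord)
  also have "\<dots> = taylor_coord g ([:0, 1:] * q) s"
    unfolding br(3) coord[OF br(2)] taylor_residue_X_mult[OF char] by simp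
  finally show ?thesis ..
qed

section \<open>Primary factorization of a monic polynomial\<close>

lemma monic_irreducible_dvd_eq:
  fixes g h :: "'a::field poly"
  assumes "monic g" "monic h" "irreducible g" "irreducible h" "g dvd h"
  shows "g = h"
proof -
  obtain c where c: "h = g * c" using assms(5) unfolding dvd_def by blast
  have "c \<noteq> 0"
  proof
    assume "c = 0"
    hence "h = 0" unfolding c by simp
    thus False using assms(2) by simp
  qed
  moreover have "is_unit c"
    using irreducibleD[OF assms(4) c] irreducible_not_unit[OF assms(3)] by blast
  ultimately have "degree c = 0" using is_unit_iff_degree by blast
  then obtain u where u: "c = [:u:]" by (rule degree_eq_zeroE)
  have "lead_coeff h = lead_coeff g * lead_coeff c" unfolding c by (rule lead_coeff_mult)
  hence "u = 1" unfolding assms(1,2) unfolding u by simp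
  thus ?thesis unfolding c u by simp
qed

lemma prime_power_prod_not_dvd:
  fixes g :: "'a::field poly"
  assumes "finite X" "irreducible g" "monic g" "g \<notin> X"
    and X: "\<And>a. a \<in> X \<Longrightarrow> monic a \<and> irreducible a"
  shows "\<not> g dvd (\<Prod>a\<in>X. a ^ m a)"
  using assms(1,4) X
proof (induction X rule: finite_induct)
  case empty
  thus ?case using assms(2) by (auto simp: irreducible_def)
next
  case (insert a X)
  have prime: "prime_elem g" using assms(2) by (rule field_poly_irreducible_imp_prime)
  show ?case
  proof
    assume "g dvd (\<Prod>a\<in>insert a X. a ^ m a)"
    hence dvd: "g dvd a ^ m a * (\<Prod>a\<in>X. a ^ m a)" using insert.hyps by simp
    have "\<not> g dvd (\<Prod>a\<in>X. a ^ m a)"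
      by (rule insert.IH) (use insert.prems in blast)+
    hence "g dvd a ^ m a" using prime_elem_dvd_multD[OF prime dvd] by blast
    hence "g dvd a" by (rule prime_elem_dvd_power[OF prime])
    moreover have "monic a" "irreducible a" using insert.prems(2)[of a] by blast+
    ultimately have "g = a" using monic_irreducible_dvd_eq assms(2,3) by blast
    thus False using insert.prems(1) by blast
  qed
qed

lemma prime_power_prod_dvd:
  fixes q :: "'a::field poly"
  assumes "finite X" and "\<And>a. a \<in> X \<Longrightarrow> monic a \<and> irreducible a \<and> a ^ m a dvd q"
  shows "(\<Prod>a\<in>X. a ^ m a) dvd q"
  using assms
proof (induction X rule: finite_induct)
  case empty
  show ?case by simp
next
  case (insert a X)
  let ?P = "\<Prod>a\<in>X. a ^ m a"
  have "?P dvd q" by (rule insert.IH) (use insert.prems in blast)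
  then obtain r where r: "q = ?P * r" unfolding dvd_def by blast
  have a: "monic a" "irreducible a" "a ^ m a dvd ?P * r"
    using insert.prems[of a] unfolding r by blast+
  have nd: "\<not> a dvd ?P"
    by (rule prime_power_prod_not_dvd[OF insert.hyps(1) a(2,1) insert.hyps(2)])
      (use insert.prems in blast)
  have "a ^ m a dvd r"
  proof (cases "m a = 0")
    case False
    thus ?thesis
      using prime_power_dvd_multD[OF field_poly_irreducible_imp_prime[OF a(2)] a(3)] nd by blast
  qed simp
  hence "?P * a ^ m a dvd q" unfolding r by (rule mult_dvd_mono[OF dvd_refl])
  thus ?case using insert.hyps by (simp add: mult.commute)
qed

text \<open>
Irreducible polynomials over a field are prime, so a monic irreducible divisor of \<open>f\<close> is one of
the bases \<open>X\<close> of a given factorization, and the exact exponent is the given one. In particular the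
set behind \<open>primary_factors\<close> is finite; for an infinite set \<open>mset_set\<close> would be empty.
\<close>
lemma monic_primary_factorization:
  fixes f :: "'a::field poly"
  assumes "monic f"
  obtains X m where "finite X" "\<And>a. a \<in> X \<Longrightarrow> monic a \<and> irreducible a \<and> m a \<ge> 1"
    "f = (\<Prod>a\<in>X. a ^ m a)" "primary_factors f = image_mset (\<lambda>a. (a, m a)) (mset_set X)"
proof -
  obtain X m' where Xm: "finite X \<and> f = (\<Prod>a\<in>X. a ^ Suc (m' a)) \<and> X \<subseteq> {q. irreducible q \<and> monic q}"
    using monic_irreducible_factorization[OF assms] by (elim exE)
  hence X: "finite X" "X \<subseteq> {q. irreducible q \<and> monic q}"
    and f0: "f = (\<Prod>a\<in>X. a ^ Suc (m' a))" by simp_all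
  define m where "m a = Suc (m' a)" for a
  have f: "f = (\<Prod>a\<in>X. a ^ m a)" unfolding m_def by (rule f0)
  have eq: "{(g, d). monic g \<and> irreducible g \<and> d \<ge> 1 \<and> g ^ d dvd f \<and> \<not> g ^ Suc d dvd f}
     = (\<lambda>a. (a, m a)) ` X" (is "?L = ?R")
  proof -
    have exact: "g ^ d dvd f \<longleftrightarrow> d \<le> m g" if g: "g \<in> X" for g d
    proof -
      let ?P = "\<Prod>a\<in>X - {g}. a ^ m a"
      have fg: "f = g ^ m g * ?P" unfolding f by (rule prod.remove[OF X(1) g])
      have irr: "irreducible g" "monic g" using X g by auto
      have nd: "\<not> g dvd ?P" by (rule prime_power_prod_not_dvd) (use X irr in auto)
      show ?thesis
      proof
        assume "d \<le> m g"
        thus "g ^ d dvd f" unfolding fg by (intro dvd_mult2 le_imp_power_dvd)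
      next
        assume d: "g ^ d dvd f"
        show "d \<le> m g"
        proof (rule ccontr)
          assume "\<not> d \<le> m g"
          hence "g ^ m g * g dvd g ^ d"
            using le_imp_power_dvd[of "Suc (m g)" d g] by (simp only: power_Suc2 not_le Suc_le_eq)
          hence "g ^ m g * g dvd g ^ m g * ?P" using d unfolding fg by (rule dvd_trans)
          moreover have "g ^ m g \<noteq> 0" using irr(1) by auto
          ultimately show False using nd dvd_mult_cancel_left[of "g ^ m g" g ?P] by blast
        qed
      qed
    qed
    have mem: "g \<in> X" if "monic g" "irreducible g" "d \<ge> 1" "g ^ d dvd f" for g d
    proof (rule ccontr)
      assume "g \<notin> X"
      hence "\<not> g dvd f" unfolding f by (intro prime_power_prod_not_dvd) (use X that in auto)
      moreover have "g dvd g ^ d" using that(3) by simp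
      ultimately show False using that(4) dvd_trans by blast
    qed
    show ?thesis
    proof (rule Set.set_eqI, rule iffI)
      fix x assume xL: "x \<in> ?L"
      obtain g d where x: "x = (g, d)" by (cases x)
      have g: "monic g" "irreducible g" "d \<ge> 1" "g ^ d dvd f" "\<not> g ^ Suc d dvd f"
        using xL unfolding x mem_Collect_eq prod.case by blast+
      have gX: "g \<in> X" by (rule mem[OF g(1-4)])
      have "d = m g" using g(4,5)[unfolded exact[OF gX]] by linarith
      thus "x \<in> ?R" using gX unfolding x by blast
    next
      fix x assume "x \<in> ?R"
      then obtain g where x: "x = (g, m g)" and g: "g \<in> X" by auto
      have "g ^ m g dvd f" "\<not> g ^ Suc (m g) dvd f" unfolding exact[OF g] by simp_all
      moreover have "monic g" "irreducible g" "m g \<ge> 1" using X(2) g by (auto simp: m_def)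
      ultimately show "x \<in> ?L" unfolding x by (simp del: power_Suc)
    qed
  qed
  have "image_mset (\<lambda>a. (a, m a)) (mset_set X) = mset_set ((\<lambda>a. (a, m a)) ` X)"
    by (rule image_mset_mset_set) (simp add: inj_on_def)
  hence "primary_factors f = image_mset (\<lambda>a. (a, m a)) (mset_set X)"
    unfolding primary_factors_def eq by (rule sym)
  moreover have "monic a \<and> irreducible a \<and> m a \<ge> 1" if "a \<in> X" for a
    using X(2) that by (auto simp: m_def)
  ultimately show ?thesis by (intro that[OF X(1) _ f])
qed

lemma primary_factors_properties:
  fixes f :: "'a::field poly"
  assumes "monic f"
  shows "\<And>g d. (g, d) \<in># primary_factors f \<Longrightarrow> monic g \<and> irreducible g \<and> d \<ge> 1 \<and> g ^ d dvd f"
    and "(\<Prod>(g, d)\<in>#primary_factors f. g ^ d) = f"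
    and "(\<And>g d. (g, d) \<in># primary_factors f \<Longrightarrow> g ^ d dvd q) \<Longrightarrow> f dvd q"
proof -
  obtain X m where X: "finite X" "\<And>a. a \<in> X \<Longrightarrow> monic a \<and> irreducible a \<and> m a \<ge> 1"
    and f: "f = (\<Prod>a\<in>X. a ^ m a)" and pf: "primary_factors f = image_mset (\<lambda>a. (a, m a)) (mset_set X)"
    using monic_primary_factorization[OF assms] by blast
  have mem: "(g, d) \<in># primary_factors f \<longleftrightarrow> g \<in> X \<and> d = m g" for g d
    unfolding pf using X(1) by auto
  show "monic g \<and> irreducible g \<and> d \<ge> 1 \<and> g ^ d dvd f" if "(g, d) \<in># primary_factors f" for g d
  proof -
    have g: "g \<in> X" "d = m g" using that mem by auto
    have "g ^ d dvd f" unfolding f g(2) by (rule dvd_prodI[OF X(1) g(1)])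
    thus ?thesis using X(2)[OF g(1)] g(2) by simp
  qed
  show "(\<Prod>(g, d)\<in>#primary_factors f. g ^ d) = f"
    unfolding pf by (subst f) (simp add: image_mset.compositionality o_def prod_unfold_prod_mset)
  show "f dvd q" if "\<And>g d. (g, d) \<in># primary_factors f \<Longrightarrow> g ^ d dvd q"
    unfolding f by (rule prime_power_prod_dvd[OF X(1)]) (use that X(2) mem in auto)
qed

section \<open>Similarity to a block diagonal matrix\<close>

text \<open>
Matrices with \<open>n\<close> rows side by side. The count \<open>n\<close> is a parameter so that the empty list yields
an \<open>n\<close> by \<open>0\<close> matrix.
\<close>
fun hcat :: "nat \<Rightarrow> 'a::zero mat list \<Rightarrow> 'a mat" where
  "hcat n [] = 0\<^sub>m n 0"
| "hcat n (S # Ss) = (let H = hcat n Ss in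
     four_block_mat S H (0\<^sub>m 0 (dim_col S)) (0\<^sub>m 0 (dim_col H)))"

lemma dim_hcat:
  assumes "\<And>S. S \<in> set Ss \<Longrightarrow> dim_row S = n"
  shows "dim_row (hcat n Ss) = n" and "dim_col (hcat n Ss) = sum_list (map dim_col Ss)"
  using assms by (induction Ss) (auto simp: Let_def)

lemma hcat_intertwines:
  fixes A :: "'a::comm_ring_1 mat"
  assumes A: "A \<in> carrier_mat n n"
    and "\<And>S B. (S, B) \<in> set SBs \<Longrightarrow>
      S \<in> carrier_mat n (dim_row B) \<and> square_mat B \<and> A * S = S * B"
  shows "A * hcat n (map fst SBs) = hcat n (map fst SBs) * diag_block_mat (map snd SBs)"
  using assms(2)
proof (induction SBs)
  case Nil
  show ?case using A by auto
next
  case (Cons SB SBs)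
  obtain S B where SB: "SB = (S, B)" by force
  define H where "H = hcat n (map fst SBs)"
  define D where "D = diag_block_mat (map snd SBs)"
  define k m where "k = dim_row B" and "m = dim_col H"
  have S: "S \<in> carrier_mat n k" and B: "B \<in> carrier_mat k k" and AS: "A * S = S * B"
    using Cons.prems[of S B] unfolding SB k_def by auto
  have dims: "dim_row H = n" "m = sum_list (map dim_col (map fst SBs))"
    using Cons.prems unfolding H_def m_def by (subst dim_hcat; force)+
  have H: "H \<in> carrier_mat n m" using dims m_def by auto
  have "dim_col S = dim_row B \<and> dim_col S = dim_col B" if "(S, B) \<in> set SBs" for S B
    using Cons.prems[of S B] that by auto
  hence eq: "map dim_col (map fst SBs) = map dim_row (map snd SBs)"
    "map dim_col (map fst SBs) = map dim_col (map snd SBs)"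
    by auto
  have D: "D \<in> carrier_mat m m"
    unfolding D_def by (rule carrier_matI) (simp_all only: dim_diag_block_mat dims(2) flip: eq)
  have AH: "A * H = H * D" unfolding H_def D_def by (rule Cons.IH) (use Cons.prems in auto)
  have hc: "hcat n (map fst (SB # SBs)) = four_block_mat S H (0\<^sub>m 0 k) (0\<^sub>m 0 m)"
    using S by (simp add: SB Let_def m_def H_def)
  have db: "diag_block_mat (map snd (SB # SBs)) = four_block_mat B (0\<^sub>m k m) (0\<^sub>m m k) D"
    using B D by (simp add: SB Let_def flip: D_def)
  have "A = four_block_mat A (0\<^sub>m n 0) (0\<^sub>m 0 n) (0\<^sub>m 0 0)" using A by (intro eq_matI) auto
  hence "A * hcat n (map fst (SB # SBs)) =
      four_block_mat A (0\<^sub>m n 0) (0\<^sub>m 0 n) (0\<^sub>m 0 0) * four_block_mat S H (0\<^sub>m 0 k) (0\<^sub>m 0 m)"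
    unfolding hc by simp
  also have "\<dots> = four_block_mat (A * S) (A * H) (0\<^sub>m 0 k) (0\<^sub>m 0 m)"
    by (subst mult_four_block_mat[of _ n n _ 0 _ 0 _ _ k _ m]) (use A S H in \<open>auto intro!: cong_four_block_mat\<close>)
  also have "\<dots> = four_block_mat (S * B) (H * D) (0\<^sub>m 0 k) (0\<^sub>m 0 m)" unfolding AS AH ..
  also have "\<dots> = four_block_mat S H (0\<^sub>m 0 k) (0\<^sub>m 0 m) * four_block_mat B (0\<^sub>m k m) (0\<^sub>m m k) D"
    by (subst mult_four_block_mat[of _ n k _ m _ 0 _ _ k _ m]) (use S H B D in \<open>auto intro!: cong_four_block_mat\<close>)
  finally show ?case unfolding hc db .
qed

text \<open>
Left kernels are stated entrywise for functions on indices, which avoids converting between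
vectors and one-row matrices.
\<close>
lemma hcat_left_kernel:
  fixes y :: "nat \<Rightarrow> 'a::comm_ring_1"
  assumes "\<And>S. S \<in> set Ss \<Longrightarrow> dim_row S = n"
    and "\<And>c. c < dim_col (hcat n Ss) \<Longrightarrow> (\<Sum>i<n. y i * hcat n Ss $$ (i, c)) = 0"
    and "S \<in> set Ss" and "c < dim_col S"
  shows "(\<Sum>i<n. y i * S $$ (i, c)) = 0"
  using assms
proof (induction Ss arbitrary: c)
  case Nil
  thus ?case by simp
next
  case (Cons T Ss)
  define H where "H = hcat n Ss"
  have T: "dim_row T = n" and H: "dim_row H = n"
    using Cons.prems(1) dim_hcat(1)[of Ss n] by (auto simp: H_def)
  have hc: "hcat n (T # Ss) = four_block_mat T H (0\<^sub>m 0 (dim_col T)) (0\<^sub>m 0 (dim_col H))"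
    by (simp add: Let_def H_def)
  have T0: "(\<Sum>i<n. y i * T $$ (i, c)) = 0" if "c < dim_col T" for c
  proof -
    have "(\<Sum>i<n. y i * T $$ (i, c)) = (\<Sum>i<n. y i * hcat n (T # Ss) $$ (i, c))"
      unfolding hc by (rule sum.cong) (use that T H in auto)
    also have "\<dots> = 0" by (rule Cons.prems(2)) (use that hc in auto)
    finally show ?thesis .
  qed
  have H0: "(\<Sum>i<n. y i * H $$ (i, c)) = 0" if "c < dim_col H" for c
  proof -
    have "(\<Sum>i<n. y i * H $$ (i, c)) = (\<Sum>i<n. y i * hcat n (T # Ss) $$ (i, dim_col T + c))"
      unfolding hc by (rule sum.cong) (use that T H in auto)
    also have "\<dots> = 0" by (rule Cons.prems(2)) (use that hc in auto)
    finally show ?thesis .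
  qed
  show ?case
  proof (cases "S = T")
    case True
    thus ?thesis using T0 Cons.prems(4) by simp
  next
    case False
    hence "S \<in> set Ss" using Cons.prems(3) by simp
    from Cons.IH[OF _ _ this Cons.prems(4)] show ?thesis
      using Cons.prems(1) H0 unfolding H_def by auto
  qed
qed

lemma similar_mat_of_intertwiner:
  fixes A B S :: "'a::field mat"
  assumes A: "A \<in> carrier_mat n n" and B: "B \<in> carrier_mat n n" and S: "S \<in> carrier_mat n n"
    and AS: "A * S = S * B"
    and ker: "\<And>y i. (\<And>c. c < n \<Longrightarrow> (\<Sum>j<n. y j * S $$ (j, c)) = 0) \<Longrightarrow> i < n \<Longrightarrow> y i = 0"
  shows "similar_mat A B"
proof -
  have "det S\<^sup>T \<noteq> 0"
  proof
    assume "det S\<^sup>T = 0"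
    then obtain v where v: "v \<in> carrier_vec n" "v \<noteq> 0\<^sub>v n" "S\<^sup>T *\<^sub>v v = 0\<^sub>v n"
      using det_0_iff_vec_prod_zero_field[of "S\<^sup>T" n] S by auto
    have "(\<Sum>j<n. v $ j * S $$ (j, c)) = 0" if "c < n" for c
    proof -
      have "(S\<^sup>T *\<^sub>v v) $ c = (\<Sum>j<n. v $ j * S $$ (j, c))"
        using that S v(1) by (simp add: scalar_prod_def atLeast0LessThan mult.commute)
      thus ?thesis using that v(3) by simp
    qed
    hence "v $ i = 0" if "i < n" for i using that ker[of "\<lambda>i. v $ i"] by blast
    hence "v = 0\<^sub>v n" using v(1) by (intro eq_vecI) auto
    with v(2) show False by simp
  qed
  hence "det S \<noteq> 0" using det_transpose[OF S] by simp
  from det_non_zero_imp_unit[OF S this, of "()"]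
  obtain R where R: "R \<in> carrier_mat n n" "R * S = 1\<^sub>m n" "S * R = 1\<^sub>m n"
    unfolding Units_def by (auto simp: ring_mat_def)
  have "A = A * (S * R)" using A R by simp
  also have "\<dots> = A * S * R" by (rule assoc_mult_mat[symmetric, OF A S R(1)])
  also have "\<dots> = S * B * R" unfolding AS ..
  finally show ?thesis using A B S R by (intro similar_matI[of _ _ S R n]) auto
qed

text \<open>
The criterion behind both halves of the proof. A family of maps that intertwine \<open>A\<close> with the
blocks, with total width equal to the size of \<open>A\<close>, only has to be jointly injective.
\<close>
lemma similar_diag_block_matI:
  fixes A :: "'a::field mat"
  assumes A: "A \<in> carrier_mat n n"
    and SB: "\<And>S B. (S, B) \<in> set SBs \<Longrightarrow>
      S \<in> carrier_mat n (dim_row B) \<and> square_mat B \<and> A * S = S * B"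
    and dim: "(\<Sum>(S, B)\<leftarrow>SBs. dim_row B) = n"
    and ker: "\<And>y i. (\<And>S B c. (S, B) \<in> set SBs \<Longrightarrow> c < dim_col S \<Longrightarrow>
      (\<Sum>j<n. y j * S $$ (j, c)) = 0) \<Longrightarrow> i < n \<Longrightarrow> y i = 0"
  shows "similar_mat A (diag_block_mat (map snd SBs))"
proof -
  let ?H = "hcat n (map fst SBs)"
  have dims: "dim_row S = n \<and> dim_col S = dim_row B \<and> dim_col B = dim_row B" if "(S, B) \<in> set SBs" for S B
    using SB[OF that] by auto
  hence rows: "dim_row S = n" if "S \<in> set (map fst SBs)" for S using that by auto
  have cols: "map dim_col (map fst SBs) = map (\<lambda>(S, B). dim_row B) SBs"
    "map dim_row (map snd SBs) = map (\<lambda>(S, B). dim_row B) SBs"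
    "map dim_col (map snd SBs) = map (\<lambda>(S, B). dim_row B) SBs"
    using dims by auto
  have H: "?H \<in> carrier_mat n n"
    using dim_hcat[of "map fst SBs" n, OF rows] by (intro carrier_matI) (simp_all only: cols dim)
  have D: "diag_block_mat (map snd SBs) \<in> carrier_mat n n"
    by (intro carrier_matI) (simp_all only: dim_diag_block_mat cols dim)
  show ?thesis
  proof (rule similar_mat_of_intertwiner[OF A D H hcat_intertwines[OF A SB]])
    fix y :: "nat \<Rightarrow> 'a" and i
    assume y: "\<And>c. c < n \<Longrightarrow> (\<Sum>j<n. y j * ?H $$ (j, c)) = 0" and i: "i < n"
    show "y i = 0"
    proof (rule ker[OF _ i])
      fix S B c assume mem: "(S, B) \<in> set SBs" and c: "c < dim_col S"
      show "(\<Sum>j<n. y j * S $$ (j, c)) = 0"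
        by (rule hcat_left_kernel[of "map fst SBs" n, OF rows _ _ c]) (use y H mem in force)+
    qed
  qed auto
qed

section \<open>Multiples of the characteristic matrix\<close>

lemma invertible_mat_inverse:
  fixes M :: "'a::comm_ring_1 mat"
  assumes M: "M \<in> carrier_mat n n" and inv: "invertible_mat M"
  obtains M' where "M' \<in> carrier_mat n n" "M * M' = 1\<^sub>m n" "M' * M = 1\<^sub>m n"
proof -
  obtain M' where M': "M * M' = 1\<^sub>m n" "M' * M = 1\<^sub>m (dim_row M')"
    using inv M unfolding invertible_mat_def inverts_mat_def by auto
  have "dim_col M' = n" using M'(1) by (metis index_mult_mat(3) index_one_mat(3))
  moreover have "dim_row M' = n"
    using M'(2) M by (metis carrier_matD(2) index_mult_mat(3) index_one_mat(3))
  ultimately have "M' \<in> carrier_mat n n" by (intro carrier_matI)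
  thus ?thesis using that M' by auto
qed

lemma char_poly_matrix_index:
  assumes "A \<in> carrier_mat n n" "i < n" "j < n"
  shows "char_poly_matrix A $$ (i, j) = (if i = j then [:0, 1:] else 0) + [:- (A $$ (i, j)):]"
  using assms by (auto simp: char_poly_matrix_def)

lemma row_times_char_poly_matrix:
  assumes A: "A \<in> carrier_mat n n" and U: "U \<in> carrier_mat nr n" and "i < nr" "j < n"
  shows "(U * char_poly_matrix A) $$ (i, j) =
    [:0, 1:] * U $$ (i, j) - (\<Sum>l<n. Polynomial.smult (A $$ (l, j)) (U $$ (i, l)))"
proof -
  have "(U * char_poly_matrix A) $$ (i, j) =
     (\<Sum>l<n. U $$ (i, l) * ((if l = j then [:0, 1:] else 0) + [:- (A $$ (l, j)):]))"
    using assms carrier_matD[OF char_poly_matrix_closed[OF A]]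
    by (simp add: scalar_prod_def atLeast0LessThan char_poly_matrix_index[OF A])
  also have "\<dots> = (\<Sum>l<n. (if l = j then U $$ (i, l) * [:0, 1:] else 0)
      - Polynomial.smult (A $$ (l, j)) (U $$ (i, l)))"
    by (intro sum.cong) (auto simp: algebra_simps)
  also have "\<dots> = [:0, 1:] * U $$ (i, j) - (\<Sum>l<n. Polynomial.smult (A $$ (l, j)) (U $$ (i, l)))"
    using assms(4) by (simp add: sum_subtractf sum.delta)
  finally show ?thesis .
qed

lemma char_poly_matrix_times_column:
  assumes A: "A \<in> carrier_mat n n" and Q: "Q \<in> carrier_mat n nc" and "i < n" "j < nc"
  shows "(char_poly_matrix A * Q) $$ (i, j) =
    [:0, 1:] * Q $$ (i, j) - (\<Sum>l<n. Polynomial.smult (A $$ (i, l)) (Q $$ (l, j)))"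
proof -
  have "(char_poly_matrix A * Q) $$ (i, j) =
     (\<Sum>l<n. ((if i = l then [:0, 1:] else 0) + [:- (A $$ (i, l)):]) * Q $$ (l, j))"
    using assms carrier_matD[OF char_poly_matrix_closed[OF A]]
    by (simp add: scalar_prod_def atLeast0LessThan char_poly_matrix_index[OF A])
  also have "\<dots> = (\<Sum>l<n. (if i = l then [:0, 1:] * Q $$ (l, j) else 0)
      - Polynomial.smult (A $$ (i, l)) (Q $$ (l, j)))"
    by (intro sum.cong) (auto simp: algebra_simps)
  also have "\<dots> = [:0, 1:] * Q $$ (i, j) - (\<Sum>l<n. Polynomial.smult (A $$ (i, l)) (Q $$ (l, j)))"
    using assms(3) by (simp add: sum_subtractf sum.delta)
  finally show ?thesis .
qed

text \<open>
The coefficient of \<open>x ^ (k + 1)\<close> in \<open>U (x I - A) = y\<close> expresses the coefficients of \<open>U\<close> at \<open>k\<close>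
by those at \<open>k + 1\<close>. They vanish for large \<open>k\<close>, so \<open>U = 0\<close>.
\<close>
lemma constant_row_multiple_eq_0:
  fixes A :: "'a::field mat"
  assumes A: "A \<in> carrier_mat n n" and U: "U \<in> carrier_mat 1 n"
    and const: "\<And>j. j < n \<Longrightarrow> (U * char_poly_matrix A) $$ (0, j) = [:y j:]"
    and "j < n"
  shows "y j = 0"
proof -
  \<comment> \<open>Any common strict upper bound of the degrees will do.\<close>
  define N where "N = (\<Sum>l<n. Suc (degree (U $$ (0, l))))"
  have top: "coeff (U $$ (0, l)) N = 0" if "l < n" for l
  proof -
    have "Suc (degree (U $$ (0, l))) \<le> N"
      unfolding N_def using that by (intro member_le_sum) auto
    thus ?thesis by (simp add: coeff_eq_0)
  qed
  have step_down: "coeff (U $$ (0, l)) k = (\<Sum>m<n. A $$ (m, l) * coeff (U $$ (0, m)) (Suc k))"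
    if "l < n" for l k
  proof -
    have "0 = coeff ((U * char_poly_matrix A) $$ (0, l)) (Suc k)"
      unfolding const[OF that] by simp
    also have "\<dots> = coeff (U $$ (0, l)) k - (\<Sum>m<n. A $$ (m, l) * coeff (U $$ (0, m)) (Suc k))"
      using row_times_char_poly_matrix[OF A U, of 0 l] that by (simp add: coeff_sum)
    finally show ?thesis by simp
  qed
  have down: "\<forall>l<n. coeff (U $$ (0, l)) k = 0" if "k \<le> N" for k
    using that
  proof (induction k rule: inc_induct)
    case base
    show ?case using top by blast
  next
    case (step k)
    show ?case
    proof (intro allI impI)
      fix l assume l: "l < n"
      show "coeff (U $$ (0, l)) k = 0"
        unfolding step_down[OF l, of k] by (rule sum.neutral) (use step.IH in simp)
    qed
  qed
  hence U0: "coeff (U $$ (0, l)) 0 = 0" if "l < n" for l using that by blast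
  have "y j = coeff ((U * char_poly_matrix A) $$ (0, j)) 0" unfolding const[OF assms(4)] by simp
  also have "\<dots> = - (\<Sum>m<n. A $$ (m, j) * coeff (U $$ (0, m)) 0)"
    using row_times_char_poly_matrix[OF A U, of 0 j] assms(4) by (simp add: coeff_sum)
  also have "\<dots> = 0" using U0 by simp
  finally show ?thesis .
qed

text \<open>
Needed to attach to each listed elementary divisor the index of an invariant factor that it comes
from, without changing the order of the given list.
\<close>
lemma mset_image_list_lift:
  assumes "mset es = image_mset h M"
  obtains xs where "mset xs = M" "map h xs = es"
proof -
  have "\<exists>xs. mset xs = M \<and> map h xs = es" using assms
  proof (induction es arbitrary: M)
    case Nil
    thus ?case by auto
  next
    case (Cons e es)
    hence "image_mset h M = add_mset e (mset es)" by simp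
    then obtain x M' where M: "M = add_mset x M'" "h x = e" "image_mset h M' = mset es"
      by (metis msed_map_invR)
    from Cons.IH[OF M(3)[symmetric]] obtain xs where "mset xs = M'" "map h xs = es" by blast
    thus ?case using M by (intro exI[of _ "x # xs"]) simp
  qed
  thus ?thesis using that by blast
qed

lemma char_poly_eq_prod_invariant_factors:
  fixes A :: "'a::field mat"
  assumes A: "A \<in> carrier_mat n n" and fs: "invariant_factors A fs"
  shows "char_poly A = prod_list fs"
proof -
  from fs A obtain P Q where PQ: "P \<in> carrier_mat n n" "Q \<in> carrier_mat n n"
      "invertible_mat P" "invertible_mat Q"
    and D: "P * char_poly_matrix A * Q = mat_diag n (\<lambda>i. fs ! i)"
    and len: "length fs = n" and monic: "\<And>f. f \<in> set fs \<Longrightarrow> monic f"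
    unfolding invariant_factors_def by auto
  have C: "char_poly_matrix A \<in> carrier_mat n n" using A by simp
  have unit: "is_unit (det M)" if M: "M \<in> carrier_mat n n" "invertible_mat M" for M :: "'a poly mat"
  proof -
    obtain M' where "M' \<in> carrier_mat n n" "M * M' = 1\<^sub>m n" using invertible_mat_inverse[OF M] by blast
    hence "det M * det M' = 1" using det_mult[OF M(1), of M'] by simp
    thus ?thesis by (rule dvdI[OF sym])
  qed
  have "det (mat_diag n (\<lambda>i. fs ! i)) = prod_list (diag_mat (mat_diag n (\<lambda>i. fs ! i)))"
    by (rule det_upper_triangular[of _ n]) (auto simp: mat_diag_def)
  also have "diag_mat (mat_diag n (\<lambda>i. fs ! i)) = fs"
    by (rule nth_equalityI) (auto simp: mat_diag_def diag_mat_def len)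
  finally have "det P * char_poly A * det Q = prod_list fs"
    using D det_mult[OF mult_carrier_mat[OF PQ(1) C] PQ(2)] det_mult[OF PQ(1) C]
    by (simp add: char_poly_def)
  moreover have "det P * det Q dvd 1 * 1" using unit PQ by (intro mult_dvd_mono)
  hence "is_unit (det P * det Q)" by simp
  hence "degree (det P * det Q) = 0" by (metis is_unit_iff_degree not_is_unit_0)
  then obtain u where u: "det P * det Q = [:u:]" by (rule degree_eq_zeroE)
  ultimately have eq: "prod_list fs = Polynomial.smult u (char_poly A)"
    by (metis (no_types, opaque_lifting) mult.commute mult.left_commute mult_pCons_left
        mult_zero_left pCons_0_0 add.right_neutral)
  have "monic (prod_list fs)" using monic
    by (induction fs) (auto simp: lead_coeff_mult simp del: One_nat_def)
  moreover have "monic (char_poly A)" using degree_monic_char_poly[OF A] by simp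
  ultimately have "u = 1" unfolding eq by (simp split: if_splits)
  thus ?thesis using eq by simp
qed

section \<open>Existence of the generalised Jordan form\<close>

lemma elementary_divisors_properties:
  fixes A :: "'a::field mat"
  assumes A: "A \<in> carrier_mat n n" and E: "elementary_divisors A (mset es)"
  shows "\<And>g d. (g, d) \<in> set es \<Longrightarrow> monic g \<and> irreducible g \<and> d \<ge> 1"
    and "char_poly A = (\<Prod>(g, d)\<leftarrow>es. g ^ d)"
    and "(\<Sum>(g, d)\<leftarrow>es. degree g * d) = n"
proof -
  obtain fs where fs: "invariant_factors A fs"
    and es: "mset es = (\<Sum>f\<in>#mset fs. primary_factors f)"
    using E unfolding elementary_divisors_def by blast
  have monic: "monic f" if "f \<in> set fs" for f
    using fs that unfolding invariant_factors_def by blast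
  show factors: "monic g \<and> irreducible g \<and> d \<ge> 1" if "(g, d) \<in> set es" for g d
  proof -
    from that have "(g, d) \<in># (\<Sum>f\<in>#mset fs. primary_factors f)"
      unfolding es[symmetric] by simp
    then obtain f where "f \<in> set fs" "(g, d) \<in># primary_factors f" by auto
    thus ?thesis using primary_factors_properties(1)[of f g d] monic by blast
  qed
  have "(\<Prod>(g, d)\<in>#(\<Sum>f\<in>#mset fs. primary_factors f). g ^ d) = prod_list fs"
    using monic
  proof (induction fs)
    case (Cons f fs)
    thus ?case using primary_factors_properties(2)[of f] by simp
  qed simp
  hence "(\<Prod>(g, d)\<leftarrow>es. g ^ d) = prod_list fs"
    unfolding es[symmetric] by (simp flip: mset_map add: prod_mset_prod_list)
  thus cp: "char_poly A = (\<Prod>(g, d)\<leftarrow>es. g ^ d)"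
    using char_poly_eq_prod_invariant_factors[OF A fs] by simp
  have "(\<Prod>(g, d)\<leftarrow>xs. g ^ d) \<noteq> 0 \<and>
      degree (\<Prod>(g, d)\<leftarrow>xs. g ^ d) = (\<Sum>(g, d)\<leftarrow>xs. degree g * d)"
    if "\<And>g d. (g, d) \<in> set xs \<Longrightarrow> g \<noteq> 0" for xs :: "('a poly \<times> nat) list"
    using that
  proof (induction xs)
    case (Cons x xs)
    obtain g d where x: "x = (g, d)" by force
    have "g \<noteq> 0" using Cons.prems[of g d] x by simp
    moreover define R where "R = (\<Prod>(g, d)\<leftarrow>xs. g ^ d)"
    moreover have "R \<noteq> 0 \<and> degree R = (\<Sum>(g, d)\<leftarrow>xs. degree g * d)"
      unfolding R_def by (rule Cons.IH) (use Cons.prems in auto)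
    moreover have "(\<Prod>(g, d)\<leftarrow>x # xs. g ^ d) = g ^ d * R"
      "(\<Sum>(g, d)\<leftarrow>x # xs. degree g * d) = degree g * d + (\<Sum>(g, d)\<leftarrow>xs. degree g * d)"
      by (simp_all add: x R_def)
    ultimately show ?case by (simp only:) (simp add: degree_mult_eq degree_power_eq mult.commute)
  qed simp
  moreover have "g \<noteq> 0" if "(g, d) \<in> set es" for g d using factors[OF that] by auto
  ultimately have "degree (char_poly A) = (\<Sum>(g, d)\<leftarrow>es. degree g * d)" unfolding cp by blast
  thus "(\<Sum>(g, d)\<leftarrow>es. degree g * d) = n" using degree_monic_char_poly[OF A] by simp
qed

text \<open>
The intertwining matrix consists, for each elementary divisor \<open>g ^ d\<close> of the \<open>i\<close>-th invariant
factor, of the Taylor coordinates of column \<open>i\<close> of \<open>Q\<close>.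
\<close>
lemma similar_to_generalised_jordan_form:
  fixes A :: "'a::field mat"
  assumes char: "CHAR('a) = 0"
    and A: "A \<in> carrier_mat n n" and E: "elementary_divisors A (mset es)"
  shows "similar_mat A (diag_block_mat (map (\<lambda>(g, d). gen_jordan_block g d) es))"
proof -
  let ?C = "char_poly_matrix A"
  obtain fs where fs: "invariant_factors A fs"
    and es: "mset es = (\<Sum>f\<in>#mset fs. primary_factors f)"
    using E unfolding elementary_divisors_def by blast
  from fs A obtain P Q where P: "P \<in> carrier_mat n n" and Q: "Q \<in> carrier_mat n n"
    and inv: "invertible_mat P" "invertible_mat Q"
    and D: "P * ?C * Q = mat_diag n (\<lambda>i. fs ! i)"
    and len: "length fs = n" and monic: "\<And>i. i < n \<Longrightarrow> monic (fs ! i)"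
    unfolding invariant_factors_def by auto
  define F where "F = mat_diag n (\<lambda>i. fs ! i)"
  have C: "?C \<in> carrier_mat n n" using A by simp
  have F: "F \<in> carrier_mat n n" by (simp add: F_def)
  obtain P' where P': "P' \<in> carrier_mat n n" "P' * P = 1\<^sub>m n"
    using invertible_mat_inverse[OF P inv(1)] by blast
  obtain Q' where Q': "Q' \<in> carrier_mat n n" "Q * Q' = 1\<^sub>m n"
    using invertible_mat_inverse[OF Q inv(2)] by blast
  \<comment> \<open>Read by columns, this says that modulo \<open>fs ! i\<close> multiplying column \<open>i\<close> of \<open>Q\<close> by \<open>x\<close> is
    the same as applying \<open>A\<close>; this gives \<open>A * T = T * B\<close> below.\<close>
  have CQ: "?C * Q = P' * F"
  proof -
    have "P' * F = P' * (P * (?C * Q))"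
      unfolding F_def D[symmetric] using P C Q by (simp add: assoc_mult_mat[of _ n n _ n _ n])
    also have "\<dots> = P' * P * (?C * Q)"
      by (rule assoc_mult_mat[symmetric, OF P'(1) P mult_carrier_mat[OF C Q]])
    also have "\<dots> = ?C * Q" unfolding P'(2) by (rule left_mult_one_mat[OF mult_carrier_mat[OF C Q]])
    finally show ?thesis ..
  qed
  have FQ': "F * Q' = P * ?C"
  proof -
    have "F * Q' = P * ?C * (Q * Q')"
      unfolding F_def D[symmetric] using P C Q Q'(1) by (simp add: assoc_mult_mat[of _ n n _ n _ n])
    also have "\<dots> = P * ?C" unfolding Q'(2) by (rule right_mult_one_mat[OF mult_carrier_mat[OF P C]])
    finally show ?thesis .
  qed
  have X: "[:0, 1:] * Q $$ (j, i) =
      (\<Sum>l<n. Polynomial.smult (A $$ (j, l)) (Q $$ (l, i))) + P' $$ (j, i) * fs ! i"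
    if "j < n" "i < n" for i j
  proof -
    have "(P' * F) $$ (j, i) = P' $$ (j, i) * fs ! i"
      unfolding F_def mat_diag_mult_right[OF P'(1)] using that by simp
    thus ?thesis using char_poly_matrix_times_column[OF A Q that] unfolding CQ
      by (simp add: algebra_simps del: mult_pCons_left)
  qed
  \<comment> \<open>The elementary divisors together with the index of the invariant factor they come from.\<close>
  define M where "M = (\<Sum>i\<in>#mset [0..<n]. image_mset (Pair i) (primary_factors (fs ! i)))"
  have "image_mset snd (\<Sum>i\<in>#I. image_mset (Pair i) (primary_factors (fs ! i))) =
      (\<Sum>i\<in>#I. primary_factors (fs ! i))" for I
    by (induction I) (simp_all add: image_mset.compositionality o_def)
  hence "image_mset snd M = (\<Sum>i\<in>#mset [0..<n]. primary_factors (fs ! i))"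
    unfolding M_def .
  also have "\<dots> = (\<Sum>f\<in>#mset (map ((!) fs) [0..<n]). primary_factors f)"
    unfolding mset_map by (simp only: image_mset.compositionality o_def)
  also have "map ((!) fs) [0..<n] = fs" using len map_nth[of fs] by simp
  finally have "mset es = image_mset snd M" using es by simp
  then obtain xs where xs: "mset xs = M" "map snd xs = es" by (rule mset_image_list_lift)
  have xsI: "(i, g, d) \<in> set xs" if "i < n" "(g, d) \<in># primary_factors (fs ! i)" for i g d
  proof -
    have "(i, g, d) \<in># M" unfolding M_def using that by auto
    thus ?thesis unfolding xs(1)[symmetric] by simp
  qed
  have xsD: "i < n \<and> monic g \<and> irreducible g \<and> g ^ d dvd fs ! i" if "(i, g, d) \<in> set xs" for i g d
  proof -
    have "(i, g, d) \<in># M" using that unfolding xs(1)[symmetric] by simp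
    hence "i < n" "(g, d) \<in># primary_factors (fs ! i)" unfolding M_def by auto
    thus ?thesis using primary_factors_properties(1)[OF monic] by blast
  qed
  define S where "S = (\<lambda>(i, g, d).
    mat n (d * degree g) (\<lambda>(j, s). taylor_coord g (Q $$ (j, i)) s))"
  define SBs where "SBs = map (\<lambda>(i, g, d). (S (i, g, d), gen_jordan_block g d)) xs"
  have snd: "map snd SBs = map (\<lambda>(g, d). gen_jordan_block g d) es"
    unfolding SBs_def xs(2)[symmetric] by (simp add: case_prod_unfold)
  have "similar_mat A (diag_block_mat (map snd SBs))"
  proof (rule similar_diag_block_matI[OF A])
    fix T B assume "(T, B) \<in> set SBs"
    then obtain i g d where T: "T = S (i, g, d)" and B: "B = gen_jordan_block g d"
      and x: "(i, g, d) \<in> set xs" unfolding SBs_def by auto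
    note props = xsD[OF x]
    let ?N = "d * degree g"
    have Tc: "T \<in> carrier_mat n ?N" by (simp add: T S_def)
    have "A * T = T * B"
    proof (rule eq_matI)
      fix j s assume "j < dim_row (T * B)" "s < dim_col (T * B)"
      hence j: "j < n" and s: "s < ?N" using Tc by (simp_all add: B)
      have "(A * T) $$ (j, s) = (\<Sum>l<n. A $$ (j, l) * taylor_coord g (Q $$ (l, i)) s)"
        using j s A by (simp add: T S_def scalar_prod_def atLeast0LessThan)
      also have "\<dots> = taylor_coord g (\<Sum>l<n. Polynomial.smult (A $$ (j, l)) (Q $$ (l, i))) s"
        by (simp add: taylor_coord_sum taylor_coord_smult)
      also have "\<dots> = taylor_coord g ([:0, 1:] * Q $$ (j, i)) s"
      proof -
        have "taylor_coord g (P' $$ (j, i) * fs ! i) s = 0"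
          using taylor_coord_eq_0_iff[OF char, of g d "P' $$ (j, i) * fs ! i"] props s
          by (auto intro: dvd_mult)
        thus ?thesis using X[OF j, of i] props
          by (simp add: taylor_coord_add del: mult_pCons_left)
      qed
      also have "\<dots> = (\<Sum>t < ?N. taylor_coord g (Q $$ (j, i)) t * B $$ (t, s))"
        unfolding B using taylor_coord_X_mult[OF char _ s] props by blast
      also have "\<dots> = (T * B) $$ (j, s)"
        using j s by (simp add: T B S_def scalar_prod_def atLeast0LessThan)
      finally show "(A * T) $$ (j, s) = (T * B) $$ (j, s)" .
    qed (use A Tc in \<open>auto simp: B\<close>)
    thus "T \<in> carrier_mat n (dim_row B) \<and> square_mat B \<and> A * T = T * B"
      using Tc by (simp add: B)
  next
    have "(\<Sum>(T, B)\<leftarrow>SBs. dim_row B) = sum_list (map dim_row (map snd SBs))"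
      by (simp add: case_prod_unfold o_def)
    also have "\<dots> = (\<Sum>(g, d)\<leftarrow>es. degree g * d)"
      unfolding snd by (simp add: case_prod_unfold o_def mult.commute)
    also have "\<dots> = n" by (rule elementary_divisors_properties(3)[OF A E])
    finally show "(\<Sum>(T, B)\<leftarrow>SBs. dim_row B) = n" .
  next
    fix y :: "nat \<Rightarrow> 'a" and m
    assume ker: "\<And>T B c. (T, B) \<in> set SBs \<Longrightarrow> c < dim_col T \<Longrightarrow> (\<Sum>j<n. y j * T $$ (j, c)) = 0"
      and m: "m < n"
    define Y where "Y = mat 1 n (\<lambda>(_, j). [:y j:])"
    have Y: "Y \<in> carrier_mat 1 n" by (simp add: Y_def)
    have YQ: "(Y * Q) $$ (0, i) = (\<Sum>j<n. Polynomial.smult (y j) (Q $$ (j, i)))" if "i < n" for i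
      using that Q by (simp add: Y_def scalar_prod_def atLeast0LessThan)
    have dvd: "fs ! i dvd (Y * Q) $$ (0, i)" if i: "i < n" for i
    proof (rule primary_factors_properties(3)[OF monic[OF i]])
      fix g d assume gd: "(g, d) \<in># primary_factors (fs ! i)"
      have x: "(i, g, d) \<in> set xs" by (rule xsI[OF i gd])
      have "taylor_coord g ((Y * Q) $$ (0, i)) s = 0" if s: "s < d * degree g" for s
      proof -
        have "(S (i, g, d), gen_jordan_block g d) \<in> set SBs"
          unfolding SBs_def using x by force
        hence "(\<Sum>j<n. y j * S (i, g, d) $$ (j, s)) = 0"
          by (rule ker) (simp add: S_def s)
        thus ?thesis unfolding YQ[OF i] using s
          by (simp add: S_def taylor_coord_sum taylor_coord_smult)
      qed
      thus "g ^ d dvd (Y * Q) $$ (0, i)" using taylor_coord_eq_0_iff[OF char] xsD[OF x] by blast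
    qed
    \<comment> \<open>Since \<open>Y * Q\<close> is divisible by \<open>F\<close>, the constant row \<open>Y\<close> is a multiple of \<open>?C\<close>.\<close>
    define W where "W = mat 1 n (\<lambda>(_, i). (Y * Q) $$ (0, i) div fs ! i)"
    have W: "W \<in> carrier_mat 1 n" by (simp add: W_def)
    have "W * F = Y * Q"
      unfolding F_def mat_diag_mult_right[OF W]
      by (rule eq_matI) (use Y Q dvd in \<open>auto simp: W_def\<close>)
    hence "Y * Q * Q' = W * F * Q'" by simp
    hence YU: "Y = W * P * ?C"
      using Y Q Q' W F P C FQ' by (simp add: assoc_mult_mat[of _ 1 n _ n _ n])
    show "y m = 0"
    proof (rule constant_row_multiple_eq_0[OF A mult_carrier_mat[OF W P] _ m])
      fix j assume "j < n"
      thus "(W * P * ?C) $$ (0, j) = [:y j:]" unfolding YU[symmetric] by (simp add: Y_def)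
    qed
  qed
  thus ?thesis unfolding snd .
qed

section \<open>Generalised Jordan blocks over a splitting field\<close>

lemma companion_times_eigenvector:
  fixes g :: "'a::field poly"
  assumes g: "monic g" and a: "poly g a = 0" and r: "r < degree g"
  shows "(\<Sum>r' < degree g. companion_matrix g $$ (r, r') * a ^ r') = a * a ^ r"
proof (cases "Suc r = degree g")
  case False
  have "(\<Sum>r' < degree g. companion_matrix g $$ (r, r') * a ^ r') =
      (\<Sum>r' < degree g. if r' = Suc r then a ^ r' else 0)"
    using r False by (intro sum.cong) (auto simp: companion_matrix_def)
  also have "\<dots> = a * a ^ r" using r False by (simp add: sum.delta)
  finally show ?thesis .
next
  case True
  have "0 = (\<Sum>i\<le>degree g. coeff g i * a ^ i)" using a by (simp add: poly_altdef)
  also have "\<dots> = (\<Sum>i<degree g. coeff g i * a ^ i) + a * a ^ r"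
    using g by (simp add: lessThan_Suc_atMost[symmetric] flip: True)
  finally have "a * a ^ r = - (\<Sum>i<degree g. coeff g i * a ^ i)"
    by (simp add: eq_neg_iff_add_eq_0 add.commute)
  also have "\<dots> = (\<Sum>r' < degree g. companion_matrix g $$ (r, r') * a ^ r')"
    unfolding sum_negf[symmetric] using r True by (intro sum.cong) (auto simp: companion_matrix_def)
  finally show ?thesis ..
qed

text \<open>
For a root \<open>a\<close> of \<open>g\<close>, the column \<open>v = (1, a, a\<^sup>2, \<dots>)\<close> is an eigenvector of the companion
matrix, and the columns with \<open>v\<close> placed in block \<open>b\<close> and zeros elsewhere, for \<open>b < d\<close>, form a
Jordan chain. Together these chains are independent: a row \<open>y\<close> orthogonal to all of them has, in
each block, the coefficients of a polynomial of degree below \<open>degree g\<close> that vanishes at all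
\<open>degree g\<close> roots.
\<close>
lemma jordan_nf_gen_jordan_block:
  fixes g :: "'a::field poly"
  assumes g: "g = (\<Prod>a\<leftarrow>as. [:- a, 1:])" and as: "distinct as" and d: "d > 0"
  shows "jordan_nf (gen_jordan_block g d) (map (\<lambda>a. (d, a)) as)"
proof -
  let ?k = "degree g"
  have mon: "monic g" unfolding g by (rule monic_prod_list) auto
  have deg: "?k = length as" unfolding g using degree_linear_factors[of uminus as] by simp
  have root: "poly g a = 0" if "a \<in> set as" for a
    unfolding g using that by (induction as) auto
  define S where "S a = mat (d * ?k) d (\<lambda>(t, c). if t div ?k = c then a ^ (t mod ?k) else 0)" for a :: 'a
  define SBs where "SBs = map (\<lambda>a. (S a, jordan_block d a)) as"
  have S: "S a $$ (b * ?k + r, c) = (if b = c then a ^ r else 0)"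
    if "b < d" "r < ?k" "c < d" for a b c r
    using that block_index_less[OF that(1,2)] by (simp add: S_def)
  have "similar_mat (gen_jordan_block g d) (diag_block_mat (map snd SBs))"
  proof (rule similar_diag_block_matI[OF gen_jordan_block_carrier])
    fix T B assume "(T, B) \<in> set SBs"
    then obtain a where T: "T = S a" and B: "B = jordan_block d a" and a: "a \<in> set as"
      unfolding SBs_def by auto
    have "gen_jordan_block g d * T = T * B"
    proof (rule eq_matI)
      fix s c assume "s < dim_row (T * B)" "c < dim_col (T * B)"
      hence s: "s < d * ?k" and c: "c < d" by (simp_all add: T B S_def)
      define b r where "b = s div ?k" and "r = s mod ?k"
      have "?k > 0" using s by (cases "?k") auto
      hence br: "b < d" "r < ?k" "s = b * ?k + r"
        using s by (simp_all add: b_def r_def less_mult_imp_div_less)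
      have "(gen_jordan_block g d * T) $$ (s, c) =
          (\<Sum>t < d * ?k. gen_jordan_block g d $$ (b * ?k + r, t) * S a $$ (t, c))"
        using s c by (simp add: T S_def scalar_prod_def atLeast0LessThan br(3))
      also have "\<dots> = (\<Sum>r' < ?k. companion_matrix g $$ (r, r') * S a $$ (b * ?k + r', c)) +
          (if Suc b < d then S a $$ (Suc b * ?k + r, c) else 0)"
        by (rule gen_jordan_block_times_column[OF br(1,2)])
      also have "(\<Sum>r' < ?k. companion_matrix g $$ (r, r') * S a $$ (b * ?k + r', c)) =
          (if b = c then a * a ^ r else 0)"
        using companion_times_eigenvector[OF mon root[OF a] br(2)] br(1) c by (simp add: S)
      also have "(if Suc b < d then S a $$ (Suc b * ?k + r, c) else 0) =
          (if Suc b = c then a ^ r else 0)"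
        using S[OF _ br(2) c, of "Suc b" a] c by auto
      also have "(if b = c then a * a ^ r else 0) + (if Suc b = c then a ^ r else 0) =
          (\<Sum>c'<d. (if b = c' then a ^ r else 0) * B $$ (c', c))"
      proof -
        have "(\<Sum>c'<d. (if b = c' then a ^ r else 0) * B $$ (c', c)) =
            (\<Sum>c'<d. if b = c' then a ^ r * B $$ (c', c) else 0)"
          by (intro sum.cong) auto
        also have "\<dots> = a ^ r * B $$ (b, c)" using br(1) by (simp add: sum.delta)
        finally show ?thesis using br(1) c by (simp add: B)
      qed
      also have "\<dots> = (\<Sum>c'<d. T $$ (s, c') * B $$ (c', c))"
        unfolding T br(3) using br(1,2) by (intro sum.cong) (simp_all add: S)
      also have "\<dots> = (T * B) $$ (s, c)"
        using s c by (simp add: T B S_def scalar_prod_def atLeast0LessThan)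
      finally show "(gen_jordan_block g d * T) $$ (s, c) = (T * B) $$ (s, c)" .
    qed (simp_all add: T B S_def)
    thus "T \<in> carrier_mat (d * ?k) (dim_row B) \<and> square_mat B \<and> gen_jordan_block g d * T = T * B"
      by (simp add: T B S_def)
  next
    show "(\<Sum>(T, B)\<leftarrow>SBs. dim_row B) = d * ?k"
      unfolding SBs_def deg by (simp add: o_def sum_list_triv mult.commute)
  next
    fix y :: "nat \<Rightarrow> 'a" and t
    assume ker: "\<And>T B c. (T, B) \<in> set SBs \<Longrightarrow> c < dim_col T \<Longrightarrow>
      (\<Sum>j<d * ?k. y j * T $$ (j, c)) = 0" and t: "t < d * ?k"
    define b r where "b = t div ?k" and "r = t mod ?k"
    have k: "?k > 0" using t by (cases "?k") auto
    hence br: "b < d" "r < ?k" "t = b * ?k + r"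
      using t by (simp_all add: b_def r_def less_mult_imp_div_less)
    define p where "p = (\<Sum>i<?k. monom (y (b * ?k + i)) i)"
    have "poly p a = 0" if a: "a \<in> set as" for a
    proof -
      have "(S a, jordan_block d a) \<in> set SBs" unfolding SBs_def using a by auto
      hence "0 = (\<Sum>j<d * ?k. y j * S a $$ (j, b))"
        by (intro ker[symmetric]) (simp_all add: S_def br)
      also have "\<dots> = (\<Sum>c<d. \<Sum>i<?k. y (c * ?k + i) * (if c = b then a ^ i else 0))"
        unfolding sum_block_index using br by (intro sum.cong) (auto simp: S)
      also have "\<dots> = (\<Sum>c<d. if c = b then \<Sum>i<?k. y (c * ?k + i) * a ^ i else 0)"
        by (intro sum.cong) auto
      also have "\<dots> = poly p a" using br(1) by (simp add: p_def poly_sum poly_monom sum.delta)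
      finally show ?thesis by simp
    qed
    moreover have "degree p < ?k"
    proof -
      have "degree p \<le> ?k - 1" unfolding p_def
        by (intro degree_sum_le) (auto intro: order.trans[OF degree_monom_le])
      thus ?thesis using k by linarith
    qed
    moreover have "p = 0 \<or> card (set as) \<le> degree p"
    proof (cases "p = 0")
      case False
      have "card (set as) \<le> card {x. poly p x = 0}"
        using False calculation(1) by (intro card_mono poly_roots_finite) auto
      also have "\<dots> \<le> degree p" by (rule card_poly_roots_bound[OF False])
      finally show ?thesis ..
    qed simp
    ultimately have "p = 0" using distinct_card[OF as] deg by linarith
    hence "0 = coeff p r" by simp
    also have "\<dots> = y (b * ?k + r)" unfolding p_def coeff_sum using br(2) by (simp add: sum.delta)
    finally show "y t = 0" using br(3) by simp
  qed
  moreover have "map snd SBs = map (\<lambda>(n, a). jordan_block n a) (map (\<lambda>a. (d, a)) as)"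
    unfolding SBs_def by simp
  ultimately show ?thesis unfolding jordan_nf_def jordan_matrix_def using d by auto
qed

section \<open>Transfer along a field homomorphism\<close>

lemma map_mat_diag_block_mat:
  assumes "f 0 = 0"
  shows "map_mat f (diag_block_mat As) = diag_block_mat (map (map_mat f) As)"
proof (induction As)
  case Nil
  show ?case by auto
next
  case (Cons A As)
  show ?case
    unfolding diag_block_mat.simps list.map Let_def Cons.IH[symmetric]
    by (rule eq_matI) (auto simp: assms)
qed

lemma (in semiring_hom) similar_mat_hom:
  assumes "similar_mat A B"
  shows "similar_mat (mat\<^sub>h A) (mat\<^sub>h B)"
proof -
  from similar_matD[OF assms] obtain n P Q where c: "{A, B, P, Q} \<subseteq> carrier_mat n n"
    and PQ: "P * Q = 1\<^sub>m n" "Q * P = 1\<^sub>m n" "A = P * B * Q"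
    by blast
  hence P: "P \<in> carrier_mat n n" and Q: "Q \<in> carrier_mat n n" and B: "B \<in> carrier_mat n n" by auto
  show ?thesis
  proof (rule similar_matI)
    show "{mat\<^sub>h A, mat\<^sub>h B, mat\<^sub>h P, mat\<^sub>h Q} \<subseteq> carrier_mat n n" using c by auto
    show "mat\<^sub>h P * mat\<^sub>h Q = 1\<^sub>m n" "mat\<^sub>h Q * mat\<^sub>h P = 1\<^sub>m n"
      by (simp_all only: mat_hom_mult[OF P Q, symmetric] mat_hom_mult[OF Q P, symmetric] PQ mat_hom_one)
    show "mat\<^sub>h A = mat\<^sub>h P * mat\<^sub>h B * mat\<^sub>h Q"
      unfolding PQ(3) mat_hom_mult[OF mult_carrier_mat[OF P B] Q] mat_hom_mult[OF P B] ..
  qed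
qed

context field_hom
begin

lemma CHAR_eq_0:
  assumes "CHAR('b) = 0"
  shows "CHAR('a) = 0"
proof -
  have "of_nat n \<noteq> (0 :: 'a)" if "n > 0" for n
  proof
    assume "of_nat n = (0 :: 'a)"
    hence "hom (of_nat n) = 0" by simp
    hence "of_nat n = (0 :: 'b)" by (simp only: hom_of_nat)
    thus False using that assms by (simp add: of_nat_eq_0_iff_char_dvd)
  qed
  thus ?thesis by (simp add: CHAR_eq0_iff)
qed

text \<open>
The polynomials over the smaller field that vanish at \<open>z\<close> are the multiples of one of least
degree, the minimal polynomial of \<open>z\<close>, of which \<open>g\<close> is a unit multiple.
\<close>
lemma irreducible_dvd_of_common_root:
  assumes g: "irreducible g" and gz: "poly (map_poly hom g) z = 0"
    and qz: "poly (map_poly hom q) z = 0"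
  shows "g dvd q"
proof -
  interpret map_poly_hom: map_poly_idom_hom hom ..
  define I where "I p \<longleftrightarrow> p \<noteq> 0 \<and> poly (map_poly hom p) z = 0" for p
  have "I g" using g gz by (auto simp: I_def)
  then obtain m where m: "I m" and min: "\<And>p. I p \<Longrightarrow> degree m \<le> degree p"
    using ex_has_least_nat[of I g degree] by blast
  have m_dvd: "m dvd p" if p: "poly (map_poly hom p) z = 0" for p
  proof (rule ccontr)
    assume "\<not> m dvd p"
    hence nz: "p mod m \<noteq> 0" by (simp add: mod_eq_0_iff_dvd)
    have "map_poly hom p = map_poly hom (p div m) * map_poly hom m + map_poly hom (p mod m)"
      by (simp flip: map_poly_hom.hom_add map_poly_hom.hom_mult)
    hence "poly (map_poly hom (p mod m)) z = 0" using p m by (simp add: I_def)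
    with nz have "degree m \<le> degree (p mod m)" by (intro min) (simp add: I_def)
    moreover have "degree (p mod m) < degree m"
      using degree_mod_less[of m p] m nz by (auto simp: I_def)
    ultimately show False by simp
  qed
  obtain c where c: "g = m * c" using m_dvd[OF gz] unfolding dvd_def by blast
  have "\<not> m dvd 1"
  proof
    assume "m dvd 1"
    then obtain e where "m = [:e:]" by (rule is_unit_polyE)
    thus False using m by (auto simp: I_def)
  qed
  hence "c dvd 1" using irreducibleD[OF g c] by blast
  hence "g dvd m" unfolding c by (simp add: mult_unit_dvd_iff)
  thus ?thesis using m_dvd[OF qz] by (rule dvd_trans)
qed

lemma map_gen_jordan_block:
  "mat\<^sub>h (gen_jordan_block g d) = gen_jordan_block (map_poly hom g) d"
proof (rule eq_matI)
  fix i j assume "i < dim_row (gen_jordan_block (map_poly hom g) d)"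
    and "j < dim_col (gen_jordan_block (map_poly hom g) d)"
  hence ij: "i < d * degree g" "j < d * degree g" by simp_all
  hence "degree g > 0" by (cases "degree g") auto
  hence "i mod degree g < degree g" "j mod degree g < degree g" by simp_all
  thus "mat\<^sub>h (gen_jordan_block g d) $$ (i, j) = gen_jordan_block (map_poly hom g) d $$ (i, j)"
    using ij by (simp add: gen_jordan_block_def companion_matrix_def Let_def hom_uminus)
qed simp_all

end

section \<open>Uniqueness of the generalised Jordan form\<close>

text \<open>
The roots are simple because a double root would be shared with the derivative, which \<open>g\<close> does
not divide.
\<close>
lemma irreducible_splits_over_complex:
  fixes g :: "'h::field poly" and \<iota> :: "'h \<Rightarrow> complex"
  assumes hom: "field_hom \<iota>" and mon: "monic g" and irr: "irreducible g"
  obtains as where "distinct as" "map_poly \<iota> g = (\<Prod>a\<leftarrow>as. [:- a, 1:])"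
    "set as = {z. poly (map_poly \<iota> g) z = 0}"
proof -
  interpret field_hom \<iota> by (rule hom)
  let ?G = "map_poly \<iota> g"
  have G: "monic ?G" using mon by simp
  have "CHAR('h) = 0" by (rule CHAR_eq_0) simp
  hence nd: "\<not> g dvd pderiv g" using irr by (rule irreducible_not_dvd_pderiv)
  have "rsquarefree ?G"
    unfolding rsquarefree_roots
  proof (intro allI notI)
    fix z assume "poly ?G z = 0 \<and> poly (pderiv ?G) z = 0"
    hence "g dvd pderiv g"
      by (intro irreducible_dvd_of_common_root[OF irr, of z]) (simp_all add: map_poly_pderiv)
    with nd show False by simp
  qed
  from complex_poly_decompose_rsquarefree[OF this]
  have eq: "?G = (\<Prod>z | poly ?G z = 0. [:- z, 1:])" unfolding G by simp
  have "finite {z. poly ?G z = 0}" using G by (intro poly_roots_finite) auto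
  then obtain as where as: "set as = {z. poly ?G z = 0}" "distinct as"
    using finite_distinct_list by blast
  have "?G = (\<Prod>z\<in>set as. [:- z, 1:])" by (subst eq) (simp only: as)
  also have "\<dots> = (\<Prod>a\<leftarrow>as. [:- a, 1:])" by (rule prod.distinct_set_conv_list[OF as(2)])
  finally show ?thesis using that as by blast
qed

text \<open>
Both lists determine a complex Jordan normal form of \<open>A\<close>, and \<open>(g, d)\<close> is counted by the
Jordan blocks of size \<open>d\<close> at one root of \<open>g\<close>.
\<close>
lemma generalised_jordan_form_unique:
  fixes \<iota> :: "'h::field \<Rightarrow> complex" and A :: "'h mat"
  assumes hom: "field_hom \<iota>"
    and es: "\<forall>(g, d)\<in>set es. monic g \<and> irreducible g \<and> d \<ge> 1"
    and es': "\<forall>(g, d)\<in>set es'. monic g \<and> irreducible g \<and> d \<ge> 1"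
    and sim: "similar_mat A (diag_block_mat (map (\<lambda>(g, d). gen_jordan_block g d) es))"
    and sim': "similar_mat A (diag_block_mat (map (\<lambda>(g, d). gen_jordan_block g d) es'))"
  shows "mset es = mset es'"
proof -
  interpret field_hom \<iota> by (rule hom)
  define roots where "roots g = (SOME as. distinct as \<and>
    map_poly \<iota> g = (\<Prod>a\<leftarrow>as. [:- a, 1:]) \<and> set as = {z. poly (map_poly \<iota> g) z = 0})" for g
  have roots: "distinct (roots g)" "map_poly \<iota> g = (\<Prod>a\<leftarrow>roots g. [:- a, 1:])"
      "set (roots g) = {z. poly (map_poly \<iota> g) z = 0}"
    if g: "monic g" "irreducible g" for g
  proof -
    have "\<exists>as. distinct as \<and> map_poly \<iota> g = (\<Prod>a\<leftarrow>as. [:- a, 1:]) \<and>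
        set as = {z. poly (map_poly \<iota> g) z = 0}"
      by (rule irreducible_splits_over_complex[OF hom g]) (intro exI conjI)
    from someI_ex[OF this, folded roots_def]
    show "distinct (roots g)" "map_poly \<iota> g = (\<Prod>a\<leftarrow>roots g. [:- a, 1:])"
      "set (roots g) = {z. poly (map_poly \<iota> g) z = 0}" by blast+
  qed
  define blocks where "blocks = (\<lambda>(g, d). map (\<lambda>a. (d :: nat, a)) (roots g))"
  have jnf: "jordan_nf (map_mat \<iota> A) (concat (map blocks xs))"
    if xs: "\<forall>(g, d)\<in>set xs. monic g \<and> irreducible g \<and> d \<ge> 1"
      and sim: "similar_mat A (diag_block_mat (map (\<lambda>(g, d). gen_jordan_block g d) xs))" for xs
  proof -
    let ?Ms = "map (\<lambda>(g, d). (gen_jordan_block (map_poly \<iota> g) d, blocks (g, d))) xs"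
    have "jordan_nf (diag_block_mat (map fst ?Ms)) (concat (map snd ?Ms))"
    proof (rule jordan_nf_diag_block_mat)
      fix B jbs assume "(B, jbs) \<in> set ?Ms"
      then obtain g d where gd: "(g, d) \<in> set xs"
        and B: "B = gen_jordan_block (map_poly \<iota> g) d" "jbs = blocks (g, d)" by auto
      have "monic g" "irreducible g" "d > 0" using xs gd by auto
      thus "jordan_nf B jbs" unfolding B blocks_def prod.case
        using jordan_nf_gen_jordan_block[OF roots(2) roots(1)] by blast
    qed
    moreover have "map fst ?Ms = map (map_mat \<iota>) (map (\<lambda>(g, d). gen_jordan_block g d) xs)"
      by (auto simp: map_gen_jordan_block)
    hence "diag_block_mat (map fst ?Ms) =
        map_mat \<iota> (diag_block_mat (map (\<lambda>(g, d). gen_jordan_block g d) xs))"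
      by (simp only: map_mat_diag_block_mat[of \<iota>, OF hom_zero])
    moreover have "map snd ?Ms = map blocks xs" by auto
    ultimately have "jordan_nf (map_mat \<iota> (diag_block_mat (map (\<lambda>(g, d). gen_jordan_block g d) xs)))
        (concat (map blocks xs))" by (simp only:)
    thus ?thesis
      using similar_mat_trans[OF similar_mat_hom[OF sim]] unfolding jordan_nf_def by blast
  qed
  have count: "length (filter ((=) (k, z)) (concat (map blocks xs))) = count (mset xs) (g, k)"
    if xs: "\<forall>(g, d)\<in>set xs. monic g \<and> irreducible g \<and> d \<ge> 1"
      and g: "monic g" "irreducible g" and z: "z \<in> set (roots g)" for xs g k z
    using xs
  proof (induction xs)
    case (Cons x xs)
    obtain h d where x: "x = (h, d)" by force
    have h: "monic h" "irreducible h" using Cons.prems unfolding x by simp_all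
    have same: "h = g" if "z \<in> set (roots h)"
    proof -
      have "g dvd h"
        using that z unfolding roots(3)[OF g] roots(3)[OF h] mem_Collect_eq
        by (intro irreducible_dvd_of_common_root[OF g(2), of z])
      thus ?thesis using monic_irreducible_dvd_eq g h by blast
    qed
    have "length (filter ((=) (k, z)) (blocks x)) = (if k = d \<and> z \<in> set (roots h) then 1 else 0)"
    proof (cases "k = d")
      case True
      have "length (filter ((=) (k, z)) (blocks x)) = length (filter ((=) z) (roots h))"
        unfolding x blocks_def using True by (simp add: filter_map o_def)
      also have "\<dots> = count (mset (roots h)) z"
        by (simp only: count_mset count_list_eq_length_filter)
      also have "\<dots> = (if z \<in> set (roots h) then 1 else 0)"
        using roots(1)[OF h] unfolding distinct_count_atmost_1 by (rule spec)
      finally show ?thesis using True by simp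
    qed (simp add: x blocks_def filter_map o_def)
    also have "k = d \<and> z \<in> set (roots h) \<longleftrightarrow> x = (g, k)" using same z unfolding x by blast
    finally have "length (filter ((=) (k, z)) (blocks x)) = (if x = (g, k) then 1 else 0)" .
    moreover have "length (filter ((=) (k, z)) (concat (map blocks xs))) = count (mset xs) (g, k)"
      by (rule Cons.IH) (use Cons.prems in simp)
    ultimately show ?case by simp
  qed simp
  show ?thesis
  proof (rule multiset_eqI)
    fix x :: "'h poly \<times> nat"
    obtain g k where x: "x = (g, k)" by force
    show "count (mset es) x = count (mset es') x"
    proof (cases "monic g \<and> irreducible g \<and> k \<ge> 1")
      case True
      hence g: "monic g" "irreducible g" and k: "k \<noteq> 0" by auto
      have "roots g \<noteq> []"
      proof
        assume "roots g = []"
        hence "map_poly \<iota> g = 1" using roots(2)[OF g] by simp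
        hence "degree (map_poly \<iota> g) = 0" by simp
        hence "degree g = 0" by simp
        thus False using degree_irreducible_pos[OF g(2)] by simp
      qed
      then obtain z where z: "z \<in> set (roots g)" using hd_in_set by blast
      show ?thesis unfolding x count[OF es g z, symmetric] count[OF es' g z, symmetric]
        compute_nr_of_jordan_blocks[OF jnf[OF es sim] k, symmetric]
        compute_nr_of_jordan_blocks[OF jnf[OF es' sim'] k, symmetric] ..
    next
      case False
      hence "x \<notin> set es" "x \<notin> set es'" using es es' x by auto
      thus ?thesis by (simp only: flip: count_mset_0_iff)
    qed
  qed
qed

section \<open>The generalised Jordan form\<close>

theorem theorem2p1:
  fixes \<iota> :: "'h::field \<Rightarrow> complex"
    and A :: "'h mat"
    and n :: nat
    and es :: "('h poly \<times> nat) list"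
  assumes "field_hom \<iota>"
    and "A \<in> carrier_mat n n"
    and "elementary_divisors A (mset es)"
  shows "char_poly A = (\<Prod>(g, d)\<leftarrow>es. g ^ d) \<and>
         (\<Sum>(g, d)\<leftarrow>es. degree g * d) = n \<and>
         (\<exists>T T'. T \<in> carrier_mat n n \<and> T' \<in> carrier_mat n n \<and>
            T * T' = 1\<^sub>m n \<and> T' * T = 1\<^sub>m n \<and>
            A = T' * diag_block_mat (map (\<lambda>(g, d). gen_jordan_block g d) es) * T) \<and>
         (\<forall>es' :: ('h poly \<times> nat) list.
            (\<forall>(g, d)\<in>set es'. monic g \<and> irreducible g \<and> d \<ge> 1) \<longrightarrow>
            similar_mat A (diag_block_mat (map (\<lambda>(g, d). gen_jordan_block g d) es')) \<longrightarrow>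
            mset (map (\<lambda>(g, d). gen_jordan_block g d) es') =
            mset (map (\<lambda>(g, d). gen_jordan_block g d) es))"
proof (intro conjI allI impI)
  note hom = assms(1) and A = assms(2) and E = assms(3)
  let ?B = "\<lambda>es. diag_block_mat (map (\<lambda>(g, d). gen_jordan_block g d) es)"
  show "char_poly A = (\<Prod>(g, d)\<leftarrow>es. g ^ d)"
    by (rule elementary_divisors_properties(2)[OF A E])
  show "(\<Sum>(g, d)\<leftarrow>es. degree g * d) = n"
    by (rule elementary_divisors_properties(3)[OF A E])
  have "CHAR('h) = 0" by (rule field_hom.CHAR_eq_0[OF hom]) simp
  hence sim: "similar_mat A (?B es)" using A E by (rule similar_to_generalised_jordan_form)
  obtain T' T where "similar_mat_wit A (?B es) T' T"
    using sim unfolding similar_mat_def by blast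
  from similar_mat_witD2[OF A this]
  show "\<exists>T T'. T \<in> carrier_mat n n \<and> T' \<in> carrier_mat n n \<and>
      T * T' = 1\<^sub>m n \<and> T' * T = 1\<^sub>m n \<and> A = T' * ?B es * T"
    by blast
  fix es' :: "('h poly \<times> nat) list"
  assume es': "\<forall>(g, d)\<in>set es'. monic g \<and> irreducible g \<and> d \<ge> 1"
    and sim': "similar_mat A (?B es')"
  have es: "\<forall>(g, d)\<in>set es. monic g \<and> irreducible g \<and> d \<ge> 1"
    using elementary_divisors_properties(1)[OF A E] by blast
  have "mset es' = mset es"
    by (rule generalised_jordan_form_unique[OF hom es' es sim' sim])
  thus "mset (map (\<lambda>(g, d). gen_jordan_block g d) es') =
      mset (map (\<lambda>(g, d). gen_jordan_block g d) es)"
    by (simp only: mset_map)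
qed

end
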